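(* Let $C, C'$ be a pair of disjoint crooked planes in $\mathbb{R}^3$ (that is, in the affine Minkowski space $\mathrm{Min}$). Then there is a crooked foliation $(C_t)_{0\le t\le 1}$, that is, a smooth family of pairwise disjoint crooked planes $C_t$, $0\le t\le 1$, with $C_0=C$ and $C_1=C'$.
   Context: Lorentzian $3$-space $\mathbb{R}^{2,1}$ is $\mathbb{R}^3$ with the symmetric bilinear form $\mathbf{u}\cdot\mathbf{v}=u_1v_1+u_2v_2-u_3v_3$, the orientation given by the standard basis, and the Lorentzian cross product $\mathbf{u}\times\mathbf{v}=(u_2v_3-u_3v_2,\;u_3v_1-u_1v_3,\;u_2v_1-u_1v_2)$. A vector $\mathbf{u}$ is unit spacelike if $\mathbf{u}\cdot\mathbf{u}=1$. $\mathrm{Min}$ denotes the affine space modeled on $\mathbb{R}^{2,1}$ (a choice of origin identifies $\mathrm{Min}$ with $\mathbb{R}^{2,1}$, i.e. with $\mathbb{R}^3$). For a unit spacelike vector $\mathbf{u}$, the stem is $S(\mathbf{u})=\{\mathbf{v}\in\mathbb{R}^{2,1} : \mathbf{u}\cdot\mathbf{v}=0 \text{ and } \mathbf{v}\cdot\mathbf{v}\le 0\}$. The linear crooked plane is $$C(\mathbf{u})=\{\mathbf{v}\in\mathbb{R}^{2,1} : \mathbf{v}\times\mathbf{w}=k\mathbf{w}\text{ for some nonzero }\mathbf{w}\in S(\mathbf{u})\text{ and some } k\in\mathbb{R}_{\ge 0}\}.$$ For $p\in\mathrm{Min}$, the crooked plane with vertex $p$ and directing vector $\mathbf{u}$ is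 $C(p,\mathbf{u})=p+C(\mathbf{u})\subset\mathrm{Min}$. Note that $C(\mathbf{u})=C(-\mathbf{u})$. A smooth family of crooked planes $C_t$, $0\le t\le 1$, is one of the form $C_t=C(p_t,\mathbf{u}_t)$ where $t\mapsto p_t\in\mathrm{Min}$ and $t\mapsto\mathbf{u}_t$ (unit spacelike) are smooth on $[0,1]$. *)

theory Defs
  imports "HOL-Analysis.Analysis"
begin

(* A choice of origin identifies the affine space Min with R^{2,1}; both are
   represented by the type real^3. *)

definition lorentz_inner :: "real^3 \<Rightarrow> real^3 \<Rightarrow> real" where
  "lorentz_inner u v = u$1 * v$1 + u$2 * v$2 - u$3 * v$3"

(* The third component has the opposite sign to that of the Euclidean cross3. *)
definition lorentz_cross :: "real^3 \<Rightarrow> real^3 \<Rightarrow> real^3" where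
  "lorentz_cross u v =
     vector [u$2 * v$3 - u$3 * v$2, u$3 * v$1 - u$1 * v$3, u$2 * v$1 - u$1 * v$2]"

definition unit_spacelike :: "real^3 \<Rightarrow> bool" where
  "unit_spacelike u \<longleftrightarrow> lorentz_inner u u = 1"

definition stem :: "real^3 \<Rightarrow> (real^3) set" where
  "stem u = {v. lorentz_inner u v = 0 \<and> lorentz_inner v v \<le> 0}"

definition linear_crooked_plane :: "real^3 \<Rightarrow> (real^3) set" where
  "linear_crooked_plane u =
     {v. \<exists>w \<in> stem u. \<exists>k\<ge>0. w \<noteq> 0 \<and> lorentz_cross v w = k *\<^sub>R w}"

definition crooked_plane_at :: "real^3 \<Rightarrow> real^3 \<Rightarrow> (real^3) set" where
  "crooked_plane_at p u = (\<lambda>v. p + v) ` linear_crooked_plane u"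

definition crooked_plane :: "(real^3) set \<Rightarrow> bool" where
  "crooked_plane C \<longleftrightarrow> (\<exists>p u. unit_spacelike u \<and> C = crooked_plane_at p u)"

(* C^infinity: g n is the n-th derivative of f on S; for an interval S = {a..b} the
   derivatives at the endpoints are one-sided. *)
definition smooth_curve_on :: "real set \<Rightarrow> (real \<Rightarrow> 'a::real_normed_vector) \<Rightarrow> bool" where
  "smooth_curve_on S f \<longleftrightarrow>
     (\<exists>g :: nat \<Rightarrow> real \<Rightarrow> 'a. (\<forall>t\<in>S. g 0 t = f t) \<and>
        (\<forall>n. \<forall>t\<in>S. (g n has_vector_derivative g (Suc n) t) (at t within S)))"

definition smooth_crooked_family :: "(real \<Rightarrow> (real^3) set) \<Rightarrow> bool" where
  "smooth_crooked_family C \<longleftrightarrow>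
     (\<exists>p u. smooth_curve_on {0..1} p \<and> smooth_curve_on {0..1} u \<and>
        (\<forall>t\<in>{0..1}. unit_spacelike (u t) \<and> C t = crooked_plane_at (p t) (u t)))"

definition crooked_foliation :: "(real \<Rightarrow> (real^3) set) \<Rightarrow> bool" where
  "crooked_foliation C \<longleftrightarrow> smooth_crooked_family C \<and> disjoint_family_on C {0..1}"

end

theory Submission
  imports Defs "HOL-Computational_Algebra.Polynomial" "HOL-Real_Asymp.Real_Asymp"
begin

text \<open>
  Describe a crooked plane by its vertex \<open>p\<close> and spinors \<open>x\<close>, \<open>y\<close> of the two null ends of its stem.
  Two crooked planes \<open>(p, x, y)\<close> and \<open>(p', x', y')\<close> are disjoint iff the geodesics \<open>xy\<close> and \<open>x'y'\<close> of
  the hyperbolic plane are distinct and do not cross, and, for every pair of distinct ends \<open>e\<close>, \<open>f\<close> of the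
  two, the form \<open>d = p' - p\<close> satisfies \<open>wedge e f * d(e, f) < 0\<close>: otherwise the null half-planes at \<open>e\<close>
  and \<open>f\<close> already meet.

  For the foliation let the spinors run linearly from \<open>x\<^sub>0, y\<^sub>0\<close> to \<open>x\<^sub>1, y\<^sub>1\<close>, and let the vertex move with
  velocity \<open>\<beta> N(y\<^sub>t) - \<alpha> N(x\<^sub>t)\<close>, where \<open>N(z) = symm z z\<close> and \<open>\<alpha>, \<beta> > 0\<close>. The cyclic order of the ends makes all the
  inequalities hold between any two times. It remains to reach the given displacement \<open>p\<^sub>1 - p\<^sub>0\<close>. The
  reachable displacements form a convex set whose closure contains the cone spanned by \<open>-N(x\<^sub>0)\<close>, \<open>N(y\<^sub>0)\<close>,
  \<open>-N(x\<^sub>1)\<close>, \<open>N(y\<^sub>1)\<close> (let \<open>\<alpha>\<close> or \<open>\<beta>\<close> concentrate at an endpoint); this cone contains the open set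
  of displacements allowed by the inequalities, and a convex set contains the interior of its closure.
\<close>

subsection \<open>Crooked planes in spinor coordinates\<close>

text \<open>Spinor coordinates: \<open>symm x x\<close> is the future null vector attached to \<open>\<plusminus>x \<in> \<real>\<^sup>2\<close>, \<open>symm\<close> is
  its polarization, and the unit spacelike vectors are the \<open>symm x y / wedge x y\<close>, whose stem is bounded
  by the null lines through \<open>symm x x\<close> and \<open>symm y y\<close>. Pairing with \<open>symm\<close> turns \<open>v\<close> into a symmetric
  bilinear form on \<open>\<real>\<^sup>2\<close>.\<close>

definition wedge :: "real \<times> real \<Rightarrow> real \<times> real \<Rightarrow> real" where
  "wedge x y = fst x * snd y - snd x * fst y"

definition symm :: "real \<times> real \<Rightarrow> real \<times> real \<Rightarrow> real^3" where
  "symm x y = vector [fst x * fst y - snd x * snd y,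
                      fst x * snd y + snd x * fst y,
                      fst x * fst y + snd x * snd y]"

text \<open>Dividing by the wedge makes the directing vector unit spacelike and cancels the scale of
  \<open>x\<close> and \<open>y\<close>, so besides \<open>p\<close> only the two null lines
  matter.\<close>

definition ends_plane :: "real^3 \<Rightarrow> real \<times> real \<Rightarrow> real \<times> real \<Rightarrow> (real^3) set" where
  "ends_plane p x y = crooked_plane_at p ((1 / wedge x y) *\<^sub>R symm x y)"

lemmas coord_simps = symm_def wedge_def lorentz_inner_def lorentz_cross_def
  vec_eq_iff forall_3 vector_3 vector_add_component vector_scaleR_component

lemma lorentz_inner_add_left: "lorentz_inner (u + v) w = lorentz_inner u w + lorentz_inner v w"
  and lorentz_inner_add_right: "lorentz_inner w (u + v) = lorentz_inner w u + lorentz_inner w v"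
  and lorentz_inner_diff_left: "lorentz_inner (u - v) w = lorentz_inner u w - lorentz_inner v w"
  and lorentz_inner_minus_left: "lorentz_inner (- u) w = - lorentz_inner u w"
  and lorentz_inner_minus_right: "lorentz_inner w (- u) = - lorentz_inner w u"
  and lorentz_inner_scaleR_left: "lorentz_inner (c *\<^sub>R u) w = c * lorentz_inner u w"
  and lorentz_inner_scaleR_right: "lorentz_inner w (c *\<^sub>R u) = c * lorentz_inner w u"
  by (simp_all add: lorentz_inner_def algebra_simps)

lemmas lorentz_inner_linear = lorentz_inner_add_left lorentz_inner_add_right
  lorentz_inner_diff_left lorentz_inner_minus_left lorentz_inner_minus_right
  lorentz_inner_scaleR_left lorentz_inner_scaleR_right

lemma lorentz_cross_linear:
  "lorentz_cross (u - v) w = lorentz_cross u w - lorentz_cross v w"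
  "lorentz_cross w (u + v) = lorentz_cross w u + lorentz_cross w v"
  "lorentz_cross w (c *\<^sub>R u) = c *\<^sub>R lorentz_cross w u"
  "lorentz_cross (c *\<^sub>R u) w = c *\<^sub>R lorentz_cross u w"
  "lorentz_cross u u = 0"
  by (simp_all add: coord_simps algebra_simps)

lemma lorentz_triple_swap:
  "lorentz_inner (lorentz_cross u v) w = - lorentz_inner (lorentz_cross u w) v"
  by (simp add: coord_simps algebra_simps)

lemma wedge_swap: "wedge y x = - wedge x y" and wedge_self [simp]: "wedge x x = 0"
  by (simp_all add: wedge_def)

lemma wedge_linear:
  "wedge (x + y) z = wedge x z + wedge y z" "wedge z (x + y) = wedge z x + wedge z y"
  "wedge (c *\<^sub>R x) z = c * wedge x z" "wedge z (c *\<^sub>R x) = c * wedge z x"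
  "wedge (- x) z = - wedge x z" "wedge z (- x) = - wedge z x"
  by (simp_all add: wedge_def algebra_simps)

lemma symm_swap: "symm y x = symm x y"
  by (simp add: coord_simps algebra_simps)

lemma symm_linear:
  "symm (x + y) z = symm x z + symm y z" "symm z (x + y) = symm z x + symm z y"
  "symm (c *\<^sub>R x) z = c *\<^sub>R symm x z" "symm z (c *\<^sub>R x) = c *\<^sub>R symm z x"
  "symm (- x) z = - symm x z" "symm z (- x) = - symm z x"
  by (simp_all add: coord_simps algebra_simps)

lemma lorentz_inner_symm:
  "lorentz_inner (symm a b) (symm c d) = - (wedge a c * wedge b d + wedge a d * wedge b c)"
  by (simp add: coord_simps algebra_simps)

text \<open>The triple product is a determinant, and the cross product of \<open>symm a a\<close>
  with \<open>symm b b\<close> is \<open>-2 * wedge a b\<close> times \<open>symm a b\<close>. This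
  turns cross products with null vectors into the pairings that occur in
  \<open>separated\<close>.\<close>

lemma lorentz_triple_symm:
  "lorentz_inner (lorentz_cross v (symm a a)) (symm b b) = -2 * wedge a b * lorentz_inner v (symm a b)"
  by (simp add: coord_simps algebra_simps)

lemma symm_nonzero: "symm x x \<noteq> 0" if "wedge x y \<noteq> 0"
proof
  assume "symm x x = 0"
  with lorentz_inner_symm[of x x y y] that show False
    by (simp add: lorentz_inner_def)
qed

lemma unit_spacelike_symm: "unit_spacelike ((1 / wedge x y) *\<^sub>R symm x y)" if "wedge x y \<noteq> 0"
  using that wedge_swap[of x y]
  by (simp add: unit_spacelike_def lorentz_inner_linear lorentz_inner_symm)

text \<open>The two equations prescribe all products of a coordinate of \<open>x\<close> with one of
  \<open>y\<close>: they form the matrix with rows \<open>h, k\<close> and \<open>k - 1, g\<close>,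
  where \<open>k = (u$2 + 1) / 2\<close>. Its determinant vanishes because \<open>u\<close> is unit
  spacelike, so it has rank one; the two cases factor it.\<close>

lemma unit_spacelike_ends:
  assumes "unit_spacelike u"
  obtains x y where "wedge x y = 1" "symm x y = u"
proof -
  define g h where "g = (u$3 - u$1) / 2" and "h = (u$1 + u$3) / 2"
  have u: "u$1 = h - g" "u$3 = h + g" by (simp_all add: g_def h_def field_simps)
  have "u$1 * u$1 + u$2 * u$2 - u$3 * u$3 = 1"
    using assms by (simp add: unit_spacelike_def lorentz_inner_def)
  then have eq: "4 * (g * h) = (u$2 - 1) * (u$2 + 1)"
    unfolding u by algebra
  show ?thesis
  proof (cases "u$2 = -1")
    case True
    then have "g * h = 0" using eq by simp
    show ?thesis
    proof (rule that)
      show "wedge (- h, 1) (-1, g) = 1" "symm (- h, 1) (-1, g) = u"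
        using \<open>g * h = 0\<close> True u by (auto simp: coord_simps)
    qed
  next
    case False
    define k where "k = (u$2 + 1) / 2"
    have k: "u$2 = 2 * k - 1" "k \<noteq> 0" using False by (auto simp: k_def field_simps)
    define m where "m = g / k"
    have m: "m * k = g" using k by (simp add: m_def)
    have "(m * h) * k = (k - 1) * k" using eq m k(1) by algebra
    then have m': "m * h = k - 1" using k(2) by simp
    show ?thesis
    proof (rule that)
      show "wedge (1, m) (h, k) = 1" "symm (1, m) (h, k) = u"
        using m m' k u by (simp_all add: coord_simps)
    qed
  qed
qed

text \<open>The coefficients are read off by pairing: the two null vectors pair to
  \<open>-2 * (wedge x y)\<^sup>2\<close>, and \<open>symm x y\<close> is orthogonal to
  both.\<close>

lemma symm_basis:
  assumes "wedge x y \<noteq> 0"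
  shows "v = (- lorentz_inner v (symm y y) / (2 * (wedge x y)\<^sup>2)) *\<^sub>R symm x x
           + (- lorentz_inner v (symm x x) / (2 * (wedge x y)\<^sup>2)) *\<^sub>R symm y y
           + (lorentz_inner v (symm x y) / (wedge x y)\<^sup>2) *\<^sub>R symm x y"
proof -
  have "2 * (wedge x y)\<^sup>2 * v$i = - lorentz_inner v (symm y y) * symm x x $ i
      - lorentz_inner v (symm x x) * symm y y $ i
      + 2 * lorentz_inner v (symm x y) * symm x y $ i" for i
    using exhaust_3[of i]
    by (auto simp: coord_simps power2_eq_square algebra_simps)
  then show ?thesis
    using assms by (auto simp: vec_eq_iff field_simps)
qed

text \<open>Orthogonality to \<open>symm x y\<close> leaves a combination of the two null vectors,
  and its square \<open>-4 * (a * b) * (wedge x y)\<^sup>2\<close> is nonpositive only if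
  \<open>a\<close> and \<open>b\<close> do not have opposite signs. A common minus sign is moved
  into \<open>c\<close>.\<close>

lemma mem_stemE:
  assumes "wedge x y \<noteq> 0" "w \<in> stem ((1 / wedge x y) *\<^sub>R symm x y)" "w \<noteq> 0"
  obtains a b c where "a \<ge> 0" "b \<ge> 0" "a + b > 0" "c \<noteq> 0"
    "w = c *\<^sub>R (a *\<^sub>R symm x x + b *\<^sub>R symm y y)"
proof -
  have 1: "lorentz_inner w (symm x y) = 0" "lorentz_inner w w \<le> 0"
    using assms
    by (auto simp: stem_def lorentz_inner_linear) (simp add: lorentz_inner_def algebra_simps)
  obtain a b where w: "w = a *\<^sub>R symm x x + b *\<^sub>R symm y y"
    using symm_basis[OF assms(1), of w] 1 by (metis add.right_neutral div_0 scaleR_zero_left)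
  have "lorentz_inner w w = - 4 * (a * b) * (wedge x y)\<^sup>2"
    unfolding w
    by (simp add: lorentz_inner_linear lorentz_inner_symm wedge_swap[of x y] power2_eq_square)
  with 1 assms have ab: "a * b \<ge> 0"
    by (simp add: zero_le_mult_iff mult_le_0_iff)
  have "a \<noteq> 0 \<or> b \<noteq> 0" using w assms by auto
  with ab consider "a \<ge> 0" "b \<ge> 0" "a + b > 0" | "a \<le> 0" "b \<le> 0" "a + b < 0"
    by (auto simp: zero_le_mult_iff)
  then show ?thesis
  proof cases
    case 1 then show ?thesis using that[of a b 1] w by simp
  next
    case 2 then show ?thesis using that[of "-a" "-b" "-1"] w by (simp add: algebra_simps)
  qed
qed

lemma symm_mem_stem:
  "symm x x \<in> stem ((1 / wedge x y) *\<^sub>R symm x y)"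
  "symm y y \<in> stem ((1 / wedge x y) *\<^sub>R symm x y)"
  by (simp_all add: stem_def lorentz_inner_linear lorentz_inner_symm)

lemma mem_ends_planeE:
  assumes "wedge x y \<noteq> 0" "z \<in> ends_plane p x y"
  obtains a b k where "a \<ge> 0" "b \<ge> 0" "a + b > 0" "k \<ge> 0"
    "lorentz_cross (z - p) (a *\<^sub>R symm x x + b *\<^sub>R symm y y)
       = k *\<^sub>R (a *\<^sub>R symm x x + b *\<^sub>R symm y y)"
proof -
  from assms(2) obtain w k where w: "w \<in> stem ((1 / wedge x y) *\<^sub>R symm x y)" "w \<noteq> 0" "k \<ge> 0"
    "lorentz_cross (z - p) w = k *\<^sub>R w"
    by (auto simp: ends_plane_def crooked_plane_at_def linear_crooked_plane_def)
  from mem_stemE[OF assms(1) w(1,2)] obtain a b c where abc: "a \<ge> 0" "b \<ge> 0" "a + b > 0" "c \<noteq> 0"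
    "w = c *\<^sub>R (a *\<^sub>R symm x x + b *\<^sub>R symm y y)" .
  let ?w = "a *\<^sub>R symm x x + b *\<^sub>R symm y y"
  have "c *\<^sub>R lorentz_cross (z - p) ?w = c *\<^sub>R (k *\<^sub>R ?w)"
    using w(4) unfolding abc(5) lorentz_cross_linear(3) by (simp only: scaleR_left_commute)
  then have "lorentz_cross (z - p) ?w = k *\<^sub>R ?w"
    using abc(4) by (metis scaleR_left_imp_eq)
  with that abc w show ?thesis by blast
qed

lemma mem_ends_planeI:
  assumes "wedge x y \<noteq> 0" "k \<ge> 0" "lorentz_cross (z - p) (symm x x) = k *\<^sub>R symm x x"
  shows "z \<in> ends_plane p x y"
proof -
  have "z - p \<in> linear_crooked_plane ((1 / wedge x y) *\<^sub>R symm x y)"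
    using assms symm_mem_stem(1) symm_nonzero unfolding linear_crooked_plane_def by blast
  then show ?thesis
    unfolding ends_plane_def crooked_plane_at_def by (rule rev_image_eqI) simp
qed

lemma linear_crooked_plane_minus: "linear_crooked_plane (- u) = linear_crooked_plane u"
  by (simp add: linear_crooked_plane_def stem_def lorentz_inner_minus_left)

lemma ends_plane_swap: "ends_plane p y x = ends_plane p x y"
proof -
  have "(1 / wedge y x) *\<^sub>R symm y x = - ((1 / wedge x y) *\<^sub>R symm x y)"
    by (simp add: wedge_swap[of x y] symm_swap[of x y])
  then show ?thesis
    by (simp add: ends_plane_def crooked_plane_at_def linear_crooked_plane_minus)
qed

lemma ends_plane_minus: "ends_plane p (- x) y = ends_plane p x y" "ends_plane p x (- y) = ends_plane p x y"
  by (simp_all add: ends_plane_def wedge_linear symm_linear)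

section \<open>Null half-planes and the disjointness criterion\<close>

lemma lorentz_cross_eigenD:
  assumes "lorentz_cross v (symm a a) = k *\<^sub>R symm a a" "wedge a b \<noteq> 0"
  shows "lorentz_inner v (symm a b) = k * wedge a b"
  using lorentz_triple_symm[of v a b] assms
  by (simp add: lorentz_inner_linear lorentz_inner_symm)

lemma lorentz_cross_eigenI:
  assumes "wedge a b \<noteq> 0" "lorentz_inner v (symm a a) = 0" "lorentz_inner v (symm a b) = k * wedge a b"
  shows "lorentz_cross v (symm a a) = k *\<^sub>R symm a a"
proof -
  obtain p q r s where ab: "a = (p, q)" "b = (r, s)" by (cases a, cases b)
  \<comment> \<open>\<open>L1\<close> and \<open>L2\<close> are the coefficients of the linear
    functional sending \<open>f\<close> to
    \<open>lorentz_inner v (symm a f) - k * wedge a f\<close>. It vanishes at the independent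
    vectors \<open>a\<close> and \<open>b\<close>, hence everywhere, and the three components of the
    claim are combinations of \<open>L1\<close> and \<open>L2\<close>.\<close>
  define L1 where "L1 = (v$1 - v$3) * p + v$2 * q + k * q"
  define L2 where "L2 = v$2 * p - (v$1 + v$3) * q - k * p"
  have 1: "L1 * p + L2 * q = 0"
    using assms(2) by (simp add: L1_def L2_def coord_simps ab algebra_simps)
  have 2: "L1 * r + L2 * s = 0"
    using assms(3) by (simp add: L1_def L2_def coord_simps ab algebra_simps)
  have 3: "p * s - q * r \<noteq> 0" using assms(1) by (simp add: wedge_def ab)
  have "L1 * (p * s - q * r) = (L1 * p + L2 * q) * s - (L1 * r + L2 * s) * q"
    by (simp add: algebra_simps)
  with 1 2 3 have L1: "L1 = 0" by (metis diff_zero mult_eq_0_iff)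
  have "L2 * (p * s - q * r) = (L1 * r + L2 * s) * p - (L1 * p + L2 * q) * r"
    by (simp add: algebra_simps)
  with 1 2 3 have "L2 = 0" by (metis diff_zero mult_eq_0_iff)
  with L1 have "p * L2 + q * L1 = 0" "p * L2 - q * L1 = 0" "q * L2 - p * L1 = 0" by simp_all
  then show ?thesis
    by (simp add: L1_def L2_def coord_simps ab algebra_simps)
qed

text \<open>The null line through \<open>p'\<close> in direction \<open>symm x' x'\<close> lies in
  the second plane, with eigenvalue 0. It meets the null plane through \<open>p\<close> orthogonal
  to \<open>symm x x\<close> in one point, found by solving for \<open>c\<close>; if the inequality
  fails, the eigenvalue \<open>k\<close> there is nonnegative and the point lies in the first plane
  too.\<close>

lemma disjoint_ends_planes_imp:
  assumes "wedge x y \<noteq> 0" "wedge x' y' \<noteq> 0"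
    and "ends_plane p x y \<inter> ends_plane p' x' y' = {}" and "wedge x x' \<noteq> 0"
  shows "wedge x x' * lorentz_inner (p' - p) (symm x x') < 0"
proof (rule ccontr)
  assume neg: "\<not> ?thesis"
  define d where "d = p' - p"
  define k where "k = lorentz_inner d (symm x x') / wedge x x'"
  define c where "c = lorentz_inner d (symm x x) / (2 * (wedge x x')\<^sup>2)"
  define v where "v = d + c *\<^sub>R symm x' x'"
  have "k \<ge> 0"
    using neg assms(4) by (auto simp: k_def d_def zero_le_divide_iff mult_less_0_iff not_less zero_le_mult_iff)
  have "lorentz_cross v (symm x x) = k *\<^sub>R symm x x"
  proof (rule lorentz_cross_eigenI)
    show "lorentz_inner v (symm x x) = 0" "lorentz_inner v (symm x x') = k * wedge x x'"
      using assms(4) by (simp_all add: v_def c_def k_def lorentz_inner_linear lorentz_inner_symm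
          wedge_swap[of x x'] power2_eq_square)
  qed fact
  then have "p + v \<in> ends_plane p x y"
    using mem_ends_planeI[of x y k "p + v" p] assms \<open>k \<ge> 0\<close> by simp
  moreover have "p + v \<in> ends_plane p' x' y'"
    using mem_ends_planeI[of x' y' 0 "p + v" p'] assms
    by (simp add: v_def d_def lorentz_cross_linear)
  ultimately show False using assms(3) by auto
qed

definition separated ::
  "real^3 \<Rightarrow> real \<times> real \<Rightarrow> real \<times> real \<Rightarrow> real \<times> real \<Rightarrow> real \<times> real \<Rightarrow> bool" where
  "separated d x y x' y' \<longleftrightarrow> (\<forall>e\<in>{x, y}. \<forall>f\<in>{x', y'}.
     wedge e f \<noteq> 0 \<longrightarrow> wedge e f * lorentz_inner d (symm e f) < 0)"

lemma disjoint_imp_separated: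
  assumes "wedge x y \<noteq> 0" "wedge x' y' \<noteq> 0"
    and "ends_plane p x y \<inter> ends_plane p' x' y' = {}"
  shows "separated (p' - p) x y x' y'"
  using assms disjoint_ends_planes_imp[of x y x' y' p p'] disjoint_ends_planes_imp[of x y y' x' p p']
    disjoint_ends_planes_imp[of y x x' y' p p'] disjoint_ends_planes_imp[of y x y' x' p p']
  by (simp add: separated_def ends_plane_swap wedge_swap[of x y] wedge_swap[of x' y'])

text \<open>At a common point, let \<open>w\<close> and \<open>w'\<close> be the stem vectors of the
  two eigenvector equations. Then the triple product of \<open>d\<close>, \<open>w\<close>,
  \<open>w'\<close> equals \<open>(k + k') * lorentz_inner w w'\<close>, which is nonpositive,
  whereas its expansion over pairs of ends is nonnegative by \<open>separated\<close>. So every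
  summand vanishes, which is possible only when both points of view use a shared end
  \<open>x\<close>, \<open>x'\<close>.\<close>

lemma separated_imp_disjoint:
  assumes "wedge x y \<noteq> 0" "wedge x' y' \<noteq> 0" "wedge x y' \<noteq> 0" "wedge y x' \<noteq> 0" "wedge y y' \<noteq> 0"
    and "separated (p' - p) x y x' y'"
  shows "ends_plane p x y \<inter> ends_plane p' x' y' = {}"
proof (rule ccontr)
  assume "\<not> ?thesis"
  then obtain z where z: "z \<in> ends_plane p x y" "z \<in> ends_plane p' x' y'" by blast
  define v where "v = z - p"
  define v' where "v' = z - p'"
  define d where "d = p' - p"
  have d: "d = v - v'" by (simp add: d_def v_def v'_def)
  have q: "wedge x y' * lorentz_inner d (symm x y') < 0"
    "wedge y x' * lorentz_inner d (symm y x') < 0"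
    "wedge y y' * lorentz_inner d (symm y y') < 0"
    "wedge x x' \<noteq> 0 \<Longrightarrow> wedge x x' * lorentz_inner d (symm x x') < 0"
    using assms by (auto simp: separated_def d_def)
  from mem_ends_planeE[OF assms(1) z(1)] obtain a b k where abk: "a \<ge> 0" "b \<ge> 0" "a + b > 0" "k \<ge> 0"
    "lorentz_cross v (a *\<^sub>R symm x x + b *\<^sub>R symm y y) = k *\<^sub>R (a *\<^sub>R symm x x + b *\<^sub>R symm y y)"
    unfolding v_def .
  from mem_ends_planeE[OF assms(2) z(2)] obtain a' b' k' where abk': "a' \<ge> 0" "b' \<ge> 0" "a' + b' > 0" "k' \<ge> 0"
    "lorentz_cross v' (a' *\<^sub>R symm x' x' + b' *\<^sub>R symm y' y') = k' *\<^sub>R (a' *\<^sub>R symm x' x' + b' *\<^sub>R symm y' y')"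
    unfolding v'_def .
  define w where "w = a *\<^sub>R symm x x + b *\<^sub>R symm y y"
  define w' where "w' = a' *\<^sub>R symm x' x' + b' *\<^sub>R symm y' y'"
  have "lorentz_inner w w' = -2 * (a * a' * (wedge x x')\<^sup>2 + a * b' * (wedge x y')\<^sup>2
     + b * a' * (wedge y x')\<^sup>2 + b * b' * (wedge y y')\<^sup>2)"
    by (simp add: w_def w'_def lorentz_inner_linear lorentz_inner_symm power2_eq_square algebra_simps)
  moreover have "0 \<le> a * a' * (wedge x x')\<^sup>2 + a * b' * (wedge x y')\<^sup>2
     + b * a' * (wedge y x')\<^sup>2 + b * b' * (wedge y y')\<^sup>2"
    using abk(1,2) abk'(1,2) by simp
  ultimately have ww: "lorentz_inner w w' \<le> 0" by simp
  have "lorentz_inner (lorentz_cross d w) w' = lorentz_inner (lorentz_cross v w) w' + lorentz_inner (lorentz_cross v' w') w"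
    unfolding d lorentz_cross_linear lorentz_inner_linear using lorentz_triple_swap[of v' w w'] by simp
  also have "\<dots> = (k + k') * lorentz_inner w w'"
    using abk(5) abk'(5) unfolding w_def[symmetric] w'_def[symmetric]
    by (simp add: lorentz_inner_linear) (simp add: lorentz_inner_def algebra_simps)
  also have "\<dots> \<le> 0" using ww abk(4) abk'(4) by (simp add: mult_nonneg_nonpos)
  finally have le: "lorentz_inner (lorentz_cross d w) w' \<le> 0" .
  define S1 where "S1 = a * a' * (wedge x x' * lorentz_inner d (symm x x'))"
  define S2 where "S2 = a * b' * (wedge x y' * lorentz_inner d (symm x y'))"
  define S3 where "S3 = b * a' * (wedge y x' * lorentz_inner d (symm y x'))"
  define S4 where "S4 = b * b' * (wedge y y' * lorentz_inner d (symm y y'))"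
  have "lorentz_inner (lorentz_cross d w) w' = -2 * (S1 + S2 + S3 + S4)"
    unfolding w_def w'_def lorentz_cross_linear lorentz_inner_linear lorentz_triple_symm
      S1_def S2_def S3_def S4_def
    by (simp add: algebra_simps)
  with le have ge: "0 \<le> S1 + S2 + S3 + S4" by simp
  have "wedge x x' * lorentz_inner d (symm x x') \<le> 0"
    using q(4) by (cases "wedge x x' = 0") auto
  then have n: "S1 \<le> 0" "S2 \<le> 0" "S3 \<le> 0" "S4 \<le> 0"
    using q(1-3) abk(1,2) abk'(1,2) unfolding S1_def S2_def S3_def S4_def
    by (simp_all add: mult_nonneg_nonpos)
  with ge have "S1 = 0" "S2 = 0" "S3 = 0" "S4 = 0" by linarith+
  then have "a * a' * wedge x x' = 0" "a * b' = 0" "b * a' = 0" "b * b' = 0" using q by (auto simp: S1_def S2_def S3_def S4_def)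
  then have deg: "b = 0" "b' = 0" "wedge x x' = 0" "a > 0" "a' > 0"
    using abk abk' by auto
  have "a *\<^sub>R lorentz_cross v (symm x x) = a *\<^sub>R (k *\<^sub>R symm x x)"
    using abk(5) deg by (simp add: lorentz_cross_linear mult.commute)
  then have e: "lorentz_cross v (symm x x) = k *\<^sub>R symm x x"
    using deg(4) by (metis scaleR_left_imp_eq less_irrefl)
  have "a' *\<^sub>R lorentz_cross v' (symm x' x') = a' *\<^sub>R (k' *\<^sub>R symm x' x')"
    using abk'(5) deg by (simp add: lorentz_cross_linear mult.commute)
  then have e': "lorentz_cross v' (symm x' x') = k' *\<^sub>R symm x' x'"
    using deg(5) by (metis scaleR_left_imp_eq less_irrefl)
  have par: "x' = (wedge y x' / wedge y x) *\<^sub>R x"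
    using deg(3) assms(1)
    by (cases x; cases y; cases x') (simp add: wedge_def field_simps)
  define c where "c = wedge y x' / wedge y x"
  have c: "c \<noteq> 0" "x' = c *\<^sub>R x"
    using assms(1,4) par by (simp_all add: c_def wedge_swap[of x y])
  have "c\<^sup>2 *\<^sub>R lorentz_cross v' (symm x x) = c\<^sup>2 *\<^sub>R (k' *\<^sub>R symm x x)"
    using e' by (simp add: c(2) symm_linear lorentz_cross_linear power2_eq_square mult.commute)
  then have e'': "lorentz_cross v' (symm x x) = k' *\<^sub>R symm x x"
    using c(1) by (metis scaleR_left_imp_eq power_not_zero)
  \<comment> \<open>Both eigenvector equations now concern the same null vector, so their difference
    is an equation for \<open>d\<close> with eigenvalue \<open>k - k'\<close>. The inequalities for
    the pairs \<open>x\<close>, \<open>y'\<close> and \<open>y\<close>, \<open>x'\<close> then force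
    opposite signs of \<open>k - k'\<close>.\<close>
  have D: "lorentz_inner d (symm x f) = (k - k') * wedge x f" if "wedge x f \<noteq> 0" for f
    using lorentz_cross_eigenD[OF e that] lorentz_cross_eigenD[OF e'' that]
    by (simp add: d lorentz_inner_linear algebra_simps)
  have "(k - k') * (wedge x y')\<^sup>2 < 0"
    using q(1) D[OF assms(3)] by (simp add: power2_eq_square mult_ac)
  then have "k < k'" by (simp add: mult_less_0_iff)
  have "wedge y x' * lorentz_inner d (symm y x') = - (k - k') * (c * wedge x y)\<^sup>2"
    by (simp add: D[OF assms(1)] c(2) wedge_linear symm_linear lorentz_inner_linear symm_swap[of y x]
        wedge_swap[of y x] power2_eq_square) algebra
  with q(2) have "(k' - k) * (c * wedge x y)\<^sup>2 < 0" by simp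
  then have "k > k'" by (simp add: mult_less_0_iff)
  with \<open>k < k'\<close> show False by simp
qed

subsection \<open>Smooth curves\<close>

text \<open>Choosing a derivative inside the class once and for all and iterating the choice gives
  the whole sequence of derivatives.\<close>

lemma smooth_curve_on_closed_class:
  assumes "\<And>f. f \<in> F \<Longrightarrow> \<exists>f'\<in>F. \<forall>t\<in>S. (f has_vector_derivative f' t) (at t within S)" "f \<in> F"
  shows "smooth_curve_on S f"
proof -
  from assms(1) obtain D where D: "\<And>f. f \<in> F \<Longrightarrow> D f \<in> F"
    "\<And>f t. f \<in> F \<Longrightarrow> t \<in> S \<Longrightarrow> (f has_vector_derivative D f t) (at t within S)"
    by metis
  have F: "(D ^^ n) f \<in> F" for n
    by (induction n) (simp_all add: assms(2) D(1))
  show ?thesis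
    unfolding smooth_curve_on_def
    by (rule exI[of _ "\<lambda>n. (D ^^ n) f"]) (simp add: D(2)[OF F])
qed

lemma smooth_curve_on_rational:
  fixes P Q :: "real poly" and v :: "'a::real_normed_vector"
  assumes "\<And>t. t \<in> S \<Longrightarrow> poly Q t \<noteq> 0"
  shows "smooth_curve_on S (\<lambda>t. (poly P t / poly Q t) *\<^sub>R v)"
proof (rule smooth_curve_on_closed_class)
  \<comment> \<open>The exponent of the denominator is left free: the quotient rule then stays in
    the class, raising \<open>k\<close> by one.\<close>
  let ?f = "\<lambda>P k t. (poly P t / poly Q t ^ k) *\<^sub>R v"
  let ?F = "{?f P k |P k. True}"
  have "(\<lambda>t. (poly P t / poly Q t) *\<^sub>R v) = ?f P 1" by simp
  then show "(\<lambda>t. (poly P t / poly Q t) *\<^sub>R v) \<in> ?F" by blast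
  fix f assume "f \<in> ?F"
  then obtain P k where f: "f = ?f P k" by blast
  define P' where "P' = pderiv P * Q - of_nat k * P * pderiv Q"
  have "(f has_vector_derivative ?f P' (Suc k) t) (at t within S)" if "t \<in> S" for t
  proof -
    have nz: "poly Q t \<noteq> 0" using assms that by blast
    have "((\<lambda>t. poly P t / poly Q t ^ k) has_field_derivative
        (poly (pderiv P) t * poly Q t ^ k - poly P t * (of_nat k * poly Q t ^ (k - 1) * poly (pderiv Q) t))
          / (poly Q t ^ k * poly Q t ^ k)) (at t within S)"
      by (rule derivative_eq_intros DERIV_subset[OF poly_DERIV] subset_UNIV refl nz power_not_zero
          | simp add: nz)+
    also have "(poly (pderiv P) t * poly Q t ^ k - poly P t * (of_nat k * poly Q t ^ (k - 1) * poly (pderiv Q) t))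
          / (poly Q t ^ k * poly Q t ^ k) = poly P' t / poly Q t ^ Suc k"
      using nz by (cases k) (simp_all add: P'_def field_simps)
    finally show ?thesis
      unfolding f has_real_derivative_iff_has_vector_derivative
      by (rule bounded_linear.has_vector_derivative[OF bounded_linear_scaleR_left])
  qed
  then show "\<exists>f'\<in>?F. \<forall>t\<in>S. (f has_vector_derivative f' t) (at t within S)"
    by (intro bexI[of _ "?f P' (Suc k)"] ballI CollectI exI[of _ P'] exI[of _ "Suc k"]) simp_all
qed

lemma smooth_curve_on_poly:
  fixes P :: "real poly" and v :: "'a::real_normed_vector"
  shows "smooth_curve_on S (\<lambda>t. poly P t *\<^sub>R v)"
  using smooth_curve_on_rational[of S 1 P v] by simp

lemma smooth_curve_on_const: "smooth_curve_on S (\<lambda>t. v)"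
  using smooth_curve_on_poly[of S 1 v] by simp

lemma smooth_curve_on_add:
  assumes "smooth_curve_on S f" "smooth_curve_on S g"
  shows "smooth_curve_on S (\<lambda>t. f t + g t)"
proof -
  from assms obtain F G where
    "\<forall>t\<in>S. F 0 t = f t" "\<forall>n. \<forall>t\<in>S. (F n has_vector_derivative F (Suc n) t) (at t within S)"
    "\<forall>t\<in>S. G 0 t = g t" "\<forall>n. \<forall>t\<in>S. (G n has_vector_derivative G (Suc n) t) (at t within S)"
    unfolding smooth_curve_on_def by blast
  then show ?thesis
    unfolding smooth_curve_on_def
    by (intro exI[of _ "\<lambda>n t. F n t + G n t"]) (auto intro!: has_vector_derivative_add)
qed

lemma smooth_curve_on_scaleR:
  assumes "smooth_curve_on S f"
  shows "smooth_curve_on S (\<lambda>t. c *\<^sub>R f t)"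
proof -
  from assms obtain F where
    "\<forall>t\<in>S. F 0 t = f t" "\<forall>n. \<forall>t\<in>S. (F n has_vector_derivative F (Suc n) t) (at t within S)"
    unfolding smooth_curve_on_def by blast
  then show ?thesis
    unfolding smooth_curve_on_def
    by (intro exI[of _ "\<lambda>n t. c *\<^sub>R F n t"])
      (auto intro!: bounded_linear.has_vector_derivative[OF bounded_linear_scaleR_right])
qed

lemma has_vector_derivative_reflect:
  assumes "\<And>t. t \<in> {0..1} \<Longrightarrow> (f has_vector_derivative f' t) (at t within {0..1::real})" "t \<in> {0..1}"
  shows "((\<lambda>t. f (1 - t)) has_vector_derivative - f' (1 - t)) (at t within {0..1})"
proof -
  have "((\<lambda>t. 1 - t) has_vector_derivative -1) (at t within {0..1::real})"
    by (auto intro!: derivative_eq_intros)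
  moreover have "(\<lambda>t. 1 - t) ` {0..1} = {0..1::real}"
    by (auto simp: image_iff intro: bexI[of _ "1 - _"])
  then have "(f has_vector_derivative f' (1 - t)) (at (1 - t) within (\<lambda>t. 1 - t) ` {0..1})"
    using assms by simp
  ultimately show ?thesis
    using vector_diff_chain_within[of "\<lambda>t. 1 - t" "-1" t "{0..1}" f "f' (1 - t)"] by (simp add: o_def)
qed

lemma smooth_curve_on_reflect:
  assumes "smooth_curve_on {0..1} f"
  shows "smooth_curve_on {0..1} (\<lambda>t. f (1 - t))"
proof -
  from assms obtain F where F:
    "\<forall>t\<in>{0..1}. F 0 t = f t" "\<And>n t. t \<in> {0..1} \<Longrightarrow> (F n has_vector_derivative F (Suc n) t) (at t within {0..1})"
    unfolding smooth_curve_on_def by blast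
  have "((\<lambda>t. (-1) ^ n *\<^sub>R F n (1 - t)) has_vector_derivative (-1) ^ n *\<^sub>R - F (Suc n) (1 - t)) (at t within {0..1})"
    if "t \<in> {0..1}" for n t
    by (intro bounded_linear.has_vector_derivative[OF bounded_linear_scaleR_right]
        has_vector_derivative_reflect F(2) that)
  with F(1) show ?thesis
    unfolding smooth_curve_on_def
    by (intro exI[of _ "\<lambda>n t. (-1) ^ n *\<^sub>R F n (1 - t)"]) simp
qed

subsection \<open>Reachable displacements of the vertex\<close>

definition interp :: "real \<times> real \<Rightarrow> real \<times> real \<Rightarrow> real \<Rightarrow> real \<times> real" where
  "interp a b t = (1 - t) *\<^sub>R a + t *\<^sub>R b"

lemma interp_flip: "interp b a (1 - t) = interp a b t"
  by (simp add: interp_def)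

text \<open>The ranges \<open>I\<close> and \<open>J\<close> are parameters so that positive,
  nonnegative and vanishing coefficients share the same closure rules; smoothness is asked of the
  curve itself.\<close>

definition drifts :: "(real \<Rightarrow> real \<times> real) \<Rightarrow> (real \<Rightarrow> real \<times> real) \<Rightarrow> real set \<Rightarrow> real set \<Rightarrow> (real \<Rightarrow> real^3) set" where
  "drifts X Y I J = {p. smooth_curve_on {0..1} p \<and> (\<exists>\<alpha> \<beta>. \<forall>t\<in>{0..1}. \<alpha> t \<in> I \<and> \<beta> t \<in> J \<and>
     (p has_vector_derivative (\<beta> t *\<^sub>R symm (Y t) (Y t) - \<alpha> t *\<^sub>R symm (X t) (X t))) (at t within {0..1}))}"

lemma driftsI:
  assumes "smooth_curve_on {0..1} p"
    and "\<And>t. t \<in> {0..1} \<Longrightarrow> \<alpha> t \<in> I" "\<And>t. t \<in> {0..1} \<Longrightarrow> \<beta> t \<in> J"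
    and "\<And>t. t \<in> {0..1} \<Longrightarrow>
      (p has_vector_derivative (\<beta> t *\<^sub>R symm (Y t) (Y t) - \<alpha> t *\<^sub>R symm (X t) (X t))) (at t within {0..1})"
  shows "p \<in> drifts X Y I J"
  unfolding drifts_def using assms by (intro CollectI conjI exI[of _ \<alpha>] exI[of _ \<beta>] ballI)

lemma drifts_add:
  assumes "p \<in> drifts X Y I J" "q \<in> drifts X Y I' J'"
    and "\<And>a b. a \<in> I \<Longrightarrow> b \<in> I' \<Longrightarrow> a + b \<in> I''" "\<And>a b. a \<in> J \<Longrightarrow> b \<in> J' \<Longrightarrow> a + b \<in> J''"
  shows "(\<lambda>t. p t + q t) \<in> drifts X Y I'' J''"
proof -
  from assms(1) obtain \<alpha> \<beta> where p: "smooth_curve_on {0..1} p"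
    "\<And>t. t \<in> {0..1} \<Longrightarrow> \<alpha> t \<in> I" "\<And>t. t \<in> {0..1} \<Longrightarrow> \<beta> t \<in> J"
    "\<And>t. t \<in> {0..1} \<Longrightarrow> (p has_vector_derivative (\<beta> t *\<^sub>R symm (Y t) (Y t) - \<alpha> t *\<^sub>R symm (X t) (X t))) (at t within {0..1})"
    unfolding drifts_def by blast
  from assms(2) obtain \<alpha>' \<beta>' where q: "smooth_curve_on {0..1} q"
    "\<And>t. t \<in> {0..1} \<Longrightarrow> \<alpha>' t \<in> I'" "\<And>t. t \<in> {0..1} \<Longrightarrow> \<beta>' t \<in> J'"
    "\<And>t. t \<in> {0..1} \<Longrightarrow> (q has_vector_derivative (\<beta>' t *\<^sub>R symm (Y t) (Y t) - \<alpha>' t *\<^sub>R symm (X t) (X t))) (at t within {0..1})"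
    unfolding drifts_def by blast
  have *: "((\<lambda>t. p t + q t) has_vector_derivative
      ((\<beta> t + \<beta>' t) *\<^sub>R symm (Y t) (Y t) - (\<alpha> t + \<alpha>' t) *\<^sub>R symm (X t) (X t))) (at t within {0..1})"
    if "t \<in> {0..1}" for t
    using has_vector_derivative_add[OF p(4) q(4), OF that that] by (simp add: algebra_simps)
  show ?thesis
    by (rule driftsI[OF smooth_curve_on_add[OF p(1) q(1)] _ _ *]) (intro assms(3,4) p q; assumption)+
qed

lemma drifts_scaleR:
  assumes "p \<in> drifts X Y I J" "\<And>a. a \<in> I \<Longrightarrow> c * a \<in> I'" "\<And>a. a \<in> J \<Longrightarrow> c * a \<in> J'"
  shows "(\<lambda>t. c *\<^sub>R p t) \<in> drifts X Y I' J'"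
proof -
  from assms(1) obtain \<alpha> \<beta> where p: "smooth_curve_on {0..1} p"
    "\<And>t. t \<in> {0..1} \<Longrightarrow> \<alpha> t \<in> I" "\<And>t. t \<in> {0..1} \<Longrightarrow> \<beta> t \<in> J"
    "\<And>t. t \<in> {0..1} \<Longrightarrow> (p has_vector_derivative (\<beta> t *\<^sub>R symm (Y t) (Y t) - \<alpha> t *\<^sub>R symm (X t) (X t))) (at t within {0..1})"
    unfolding drifts_def by blast
  have *: "((\<lambda>t. c *\<^sub>R p t) has_vector_derivative
      ((c * \<beta> t) *\<^sub>R symm (Y t) (Y t) - (c * \<alpha> t) *\<^sub>R symm (X t) (X t))) (at t within {0..1})"
    if "t \<in> {0..1}" for t
    using bounded_linear.has_vector_derivative[OF bounded_linear_scaleR_right p(4)[OF that], of c]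
    by (simp add: algebra_simps)
  show ?thesis
    by (rule driftsI[OF smooth_curve_on_scaleR[OF p(1)] _ _ *]) (intro assms(2,3) p; assumption)+
qed

definition displacements ::
  "(real \<Rightarrow> real \<times> real) \<Rightarrow> (real \<Rightarrow> real \<times> real) \<Rightarrow> real set \<Rightarrow> real set \<Rightarrow> (real^3) set" where
  "displacements X Y I J = (\<lambda>p. p 1 - p 0) ` drifts X Y I J"

lemma displacements_add:
  assumes "d \<in> displacements X Y I J" "e \<in> displacements X Y I' J'"
    and "\<And>a b. a \<in> I \<Longrightarrow> b \<in> I' \<Longrightarrow> a + b \<in> I''" "\<And>a b. a \<in> J \<Longrightarrow> b \<in> J' \<Longrightarrow> a + b \<in> J''"
  shows "d + e \<in> displacements X Y I'' J''"
proof -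
  from assms(1,2) obtain p q where "p \<in> drifts X Y I J" "d = p 1 - p 0" "q \<in> drifts X Y I' J'" "e = q 1 - q 0"
    by (auto simp: displacements_def)
  with drifts_add[OF _ _ assms(3,4)] show ?thesis
    unfolding displacements_def by (intro rev_image_eqI[of "\<lambda>t. p t + q t"]) auto
qed

lemma displacements_scaleR:
  assumes "d \<in> displacements X Y I J" "\<And>a. a \<in> I \<Longrightarrow> c * a \<in> I'" "\<And>a. a \<in> J \<Longrightarrow> c * a \<in> J'"
  shows "c *\<^sub>R d \<in> displacements X Y I' J'"
proof -
  from assms(1) obtain p where "p \<in> drifts X Y I J" "d = p 1 - p 0"
    by (auto simp: displacements_def)
  with drifts_scaleR[OF _ assms(2,3)] show ?thesis
    unfolding displacements_def by (intro rev_image_eqI[of "\<lambda>t. c *\<^sub>R p t"]) (auto simp: scaleR_diff_right)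
qed

lemma convex_displacements: "convex (displacements X Y {0<..} {0<..})"
proof (rule convexI)
  fix d e and u v :: real
  assume *: "d \<in> displacements X Y {0<..} {0<..}" "e \<in> displacements X Y {0<..} {0<..}"
    "0 \<le> u" "0 \<le> v" "u + v = 1"
  show "u *\<^sub>R d + v *\<^sub>R e \<in> displacements X Y {0<..} {0<..}"
  \<comment> \<open>Scaling by a zero weight would lose the strict positivity of the
    coefficients.\<close>
  proof (cases "u = 0 \<or> v = 0")
    case True
    with * show ?thesis by auto
  next
    case False
    with * have "u *\<^sub>R d \<in> displacements X Y {0<..} {0<..}" "v *\<^sub>R e \<in> displacements X Y {0<..} {0<..}"
      by (auto intro!: displacements_scaleR)
    then show ?thesis by (rule displacements_add) auto
  qed
qed

text \<open>The integral over \<open>0 \<le> r \<le> 1\<close> of \<open>(n + 1) r\<^sup>n\<close> times the null vector of \<open>interp a b r\<close>;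
  the weight concentrates at \<open>r = 1\<close> as \<open>n\<close> grows.\<close>

definition bump :: "nat \<Rightarrow> real \<times> real \<Rightarrow> real \<times> real \<Rightarrow> real^3" where
  "bump n a b = symm a a + (2 * (real n + 1) / (real n + 2)) *\<^sub>R (symm a b - symm a a)
     + ((real n + 1) / (real n + 3)) *\<^sub>R (symm a a - 2 *\<^sub>R symm a b + symm b b)"

lemma bump_tendsto: "(\<lambda>n. bump n a b) \<longlonglongrightarrow> symm b b"
proof -
  have 1: "(\<lambda>n. 2 * (real n + 1) / (real n + 2)) \<longlonglongrightarrow> 2" and 2: "(\<lambda>n. (real n + 1) / (real n + 3)) \<longlonglongrightarrow> 1"
    by real_asymp+
  have "(\<lambda>n. bump n a b) \<longlonglongrightarrow> symm a a + 2 *\<^sub>R (symm a b - symm a a) + 1 *\<^sub>R (symm a a - 2 *\<^sub>R symm a b + symm b b)"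
    unfolding bump_def by (intro tendsto_add tendsto_scaleR 1 2 tendsto_const)
  moreover have "symm a a + 2 *\<^sub>R (symm a b - symm a a) + 1 *\<^sub>R (symm a a - 2 *\<^sub>R symm a b + symm b b) = symm b b"
    by (simp add: vec_eq_iff)
  ultimately show ?thesis by metis
qed

lemma bump_curve:
  obtains q where "smooth_curve_on {0..1} q" "q 1 - q 0 = bump n a b"
    "\<And>t. (q has_vector_derivative ((real n + 1) * t ^ n) *\<^sub>R symm (interp a b t) (interp a b t)) (at t within S)"
proof
  let ?c = "2 *\<^sub>R (symm a b - symm a a)" and ?d = "symm a a - 2 *\<^sub>R symm a b + symm b b"
  \<comment> \<open>\<open>?m m\<close> is the antiderivative of \<open>(n + 1) * t ^ m\<close> that
    vanishes at 0; the null vector of \<open>interp a b t\<close> is quadratic in \<open>t\<close>,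
    so three of them suffice.\<close>
  let ?m = "\<lambda>m. monom ((real n + 1) / real (Suc m)) (Suc m)"
  let ?q = "\<lambda>t. poly (?m n) t *\<^sub>R symm a a + poly (?m (n + 1)) t *\<^sub>R ?c + poly (?m (n + 2)) t *\<^sub>R ?d"
  show "smooth_curve_on {0..1} ?q"
    by (intro smooth_curve_on_add smooth_curve_on_poly)
  show "?q 1 - ?q 0 = bump n a b"
    by (simp add: bump_def poly_monom power_0_left algebra_simps)
  fix t
  have e: "symm (interp a b t) (interp a b t) = symm a a + t *\<^sub>R ?c + t\<^sup>2 *\<^sub>R ?d"
    unfolding interp_def symm_linear symm_swap[of b a]
    by (simp add: vec_eq_iff power2_eq_square algebra_simps)
  have e': "((real n + 1) * t ^ n) *\<^sub>R symm (interp a b t) (interp a b t) = ((real n + 1) * t ^ n) *\<^sub>R symm a a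
      + ((real n + 1) * t ^ (n + 1)) *\<^sub>R ?c + ((real n + 1) * t ^ (n + 2)) *\<^sub>R ?d"
    unfolding e by (simp add: vec_eq_iff power2_eq_square algebra_simps)
  have "(poly (?m m) has_vector_derivative (real n + 1) * t ^ m) (at t within S)" for m
    using DERIV_cmult[OF DERIV_pow[of "Suc m" t S], of "(real n + 1) / real (Suc m)"]
    by (simp add: poly_monom[abs_def] has_real_derivative_iff_has_vector_derivative)
  then have "(?q has_vector_derivative ((real n + 1) * t ^ n) *\<^sub>R symm a a
      + ((real n + 1) * t ^ (n + 1)) *\<^sub>R ?c + ((real n + 1) * t ^ (n + 2)) *\<^sub>R ?d) (at t within S)"
    by (intro has_vector_derivative_add bounded_linear.has_vector_derivative[OF bounded_linear_scaleR_left])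
  then show "(?q has_vector_derivative ((real n + 1) * t ^ n) *\<^sub>R symm (interp a b t) (interp a b t)) (at t within S)"
    unfolding e' .
qed

text \<open>The weight is constantly 1 for \<open>n = 0\<close>, which will provide strictly
  positive coefficients; for larger \<open>n\<close> it vanishes at one endpoint and is only
  nonnegative. Concentration at time 0 instead of time 1 comes from reversing time.\<close>

lemma displacements_bump:
  fixes n a b c d
  defines "X \<equiv> interp a b" and "Y \<equiv> interp c d"
    and "I \<equiv> {if n = 0 then 1 else (0::real)..}"
  shows "- bump n a b \<in> displacements X Y I {0}" "- bump n b a \<in> displacements X Y I {0}"
    "bump n c d \<in> displacements X Y {0} I" "bump n d c \<in> displacements X Y {0} I"
proof -
  have I: "(real n + 1) * t ^ n \<in> I" "(real n + 1) * (1 - t) ^ n \<in> I" if "t \<in> {0..1}" for t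
    using that by (auto simp: I_def)
  have *: "\<exists>q. smooth_curve_on {0..1} q \<and> q 1 - q 0 = bump n a b \<and> (\<forall>t\<in>{0..1}.
     (q has_vector_derivative ((real n + 1) * t ^ n) *\<^sub>R symm (interp a b t) (interp a b t)) (at t within {0..1}))" for a b
    by (rule bump_curve[of n a b "{0..1}"]) blast
  have **: "\<exists>q. smooth_curve_on {0..1} q \<and> q 1 - q 0 = bump n b a \<and> (\<forall>t\<in>{0..1}.
     (q has_vector_derivative ((real n + 1) * (1 - t) ^ n) *\<^sub>R symm (interp a b t) (interp a b t)) (at t within {0..1}))" for a b
  proof -
    from *[of b a] obtain q where q: "smooth_curve_on {0..1} q" "q 1 - q 0 = bump n b a"
      "\<And>t. t \<in> {0..1} \<Longrightarrow> (q has_vector_derivative ((real n + 1) * t ^ n) *\<^sub>R symm (interp b a t) (interp b a t)) (at t within {0..1})"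
      by blast
    have "((\<lambda>t. (-1) *\<^sub>R q (1 - t)) has_vector_derivative
        (-1) *\<^sub>R - (((real n + 1) * (1 - t) ^ n) *\<^sub>R symm (interp b a (1 - t)) (interp b a (1 - t)))) (at t within {0..1})"
      if "t \<in> {0..1}" for t
      using has_vector_derivative_reflect[OF q(3) that]
      by (intro bounded_linear.has_vector_derivative[OF bounded_linear_scaleR_right]) auto
    then show ?thesis
      using q(1,2) smooth_curve_on_scaleR[OF smooth_curve_on_reflect[OF q(1)], of "-1"]
      by (intro exI[of _ "\<lambda>t. (-1) *\<^sub>R q (1 - t)"]) (auto simp: interp_flip)
  qed
  have A: "- d \<in> displacements X Y I {0}" if "smooth_curve_on {0..1} q" "q 1 - q 0 = d"
     "\<And>t. t\<in>{0..1} \<Longrightarrow> k t \<in> I \<and> (q has_vector_derivative k t *\<^sub>R symm (X t) (X t)) (at t within {0..1})" for q d k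
  proof -
    have "(\<lambda>t. - q t) \<in> drifts X Y I {0}"
      using that smooth_curve_on_scaleR[OF that(1), of "-1"]
      by (intro driftsI[where \<alpha> = k and \<beta> = "\<lambda>_. 0"])
        (auto intro: has_vector_derivative_minus)
    with that(2) show ?thesis unfolding displacements_def by (auto intro!: rev_image_eqI)
  qed
  have B: "d \<in> displacements X Y {0} I" if "smooth_curve_on {0..1} q" "q 1 - q 0 = d"
     "\<And>t. t\<in>{0..1} \<Longrightarrow> k t \<in> I \<and> (q has_vector_derivative k t *\<^sub>R symm (Y t) (Y t)) (at t within {0..1})" for q d k
  proof -
    have "q \<in> drifts X Y {0} I"
      using that by (intro driftsI[where \<alpha> = "\<lambda>_. 0" and \<beta> = k]) auto
    with that(2) show ?thesis unfolding displacements_def by (auto intro!: rev_image_eqI)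
  qed
  from *[of a b] show "- bump n a b \<in> displacements X Y I {0}"
    unfolding X_def[symmetric] using A[where k = "\<lambda>t. (real n + 1) * t ^ n"] I(1) by metis
  from **[of b a] show "- bump n b a \<in> displacements X Y I {0}"
    unfolding X_def[symmetric] using A[where k = "\<lambda>t. (real n + 1) * (1 - t) ^ n"] I(2) by metis
  from *[of c d] show "bump n c d \<in> displacements X Y {0} I"
    unfolding Y_def[symmetric] using B[where k = "\<lambda>t. (real n + 1) * t ^ n"] I(1) by metis
  from **[of d c] show "bump n d c \<in> displacements X Y {0} I"
    unfolding Y_def[symmetric] using B[where k = "\<lambda>t. (real n + 1) * (1 - t) ^ n"] I(2) by metis
qed

lemma displacements_pos_nonempty: "\<exists>d. d \<in> displacements (interp a b) (interp c e) {0<..} {0<..}"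
proof -
  have "- bump 0 a b + bump 0 c e \<in> displacements (interp a b) (interp c e) {0<..} {0<..}"
    by (rule displacements_add[OF displacements_bump(1,3)[where n = 0, simplified]]) auto
  then show ?thesis ..
qed

text \<open>Bumps concentrating at the endpoints approximate the given vector, but with coefficients
  that are only nonnegative. Adding a vanishing multiple of a displacement \<open>d\<close> with
  positive coefficients repairs this without changing the limit.\<close>

lemma cone_subset_closure_displacements:
  assumes "a0 \<ge> 0" "a1 \<ge> 0" "b0 \<ge> 0" "b1 \<ge> 0"
  shows "b0 *\<^sub>R symm y0 y0 - a0 *\<^sub>R symm x0 x0 + b1 *\<^sub>R symm y1 y1 - a1 *\<^sub>R symm x1 x1
    \<in> closure (displacements (interp x0 x1) (interp y0 y1) {0<..} {0<..})"
proof -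
  let ?D = "displacements (interp x0 x1) (interp y0 y1)"
  obtain d where d: "d \<in> ?D {0<..} {0<..}" using displacements_pos_nonempty by blast
  define e where "e n = a0 *\<^sub>R (- bump (Suc n) x1 x0) + a1 *\<^sub>R (- bump (Suc n) x0 x1)
     + (b0 *\<^sub>R bump (Suc n) y1 y0 + b1 *\<^sub>R bump (Suc n) y0 y1)" for n
  have B: "- bump (Suc n) x0 x1 \<in> ?D {0..} {0}" "- bump (Suc n) x1 x0 \<in> ?D {0..} {0}"
    "bump (Suc n) y0 y1 \<in> ?D {0} {0..}" "bump (Suc n) y1 y0 \<in> ?D {0} {0..}" for n
    using displacements_bump[where n = "Suc n"] by simp_all
  have "a0 *\<^sub>R (- bump (Suc n) x1 x0) \<in> ?D {0..} {0}" "a1 *\<^sub>R (- bump (Suc n) x0 x1) \<in> ?D {0..} {0}"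
    "b0 *\<^sub>R bump (Suc n) y1 y0 \<in> ?D {0} {0..}" "b1 *\<^sub>R bump (Suc n) y0 y1 \<in> ?D {0} {0..}" for n
    by (rule displacements_scaleR[OF B(2)] displacements_scaleR[OF B(1)]
        displacements_scaleR[OF B(4)] displacements_scaleR[OF B(3)]; use assms in simp)+
  note s = this
  have "a0 *\<^sub>R (- bump (Suc n) x1 x0) + a1 *\<^sub>R (- bump (Suc n) x0 x1) \<in> ?D {0..} {0}"
    "b0 *\<^sub>R bump (Suc n) y1 y0 + b1 *\<^sub>R bump (Suc n) y0 y1 \<in> ?D {0} {0..}" for n
    by (rule displacements_add[OF s(1,2)] displacements_add[OF s(3,4)]; simp)+
  then have e: "e n \<in> ?D {0..} {0..}" for n
    unfolding e_def by (rule displacements_add) auto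
  have "(1 / (real n + 1)) *\<^sub>R d \<in> ?D {0<..} {0<..}" for n
    by (rule displacements_scaleR[OF d]) auto
  with e have m: "e n + (1 / (real n + 1)) *\<^sub>R d \<in> ?D {0<..} {0<..}" for n
    by (rule displacements_add) auto
  have b: "(\<lambda>n. bump (Suc n) a b) \<longlonglongrightarrow> symm b b" for a b
    using LIMSEQ_Suc[OF bump_tendsto] .
  have z: "(\<lambda>n. 1 / (real n + 1)) \<longlonglongrightarrow> 0" by real_asymp
  have "(\<lambda>n. e n + (1 / (real n + 1)) *\<^sub>R d) \<longlonglongrightarrow> a0 *\<^sub>R (- symm x0 x0) + a1 *\<^sub>R (- symm x1 x1)
     + (b0 *\<^sub>R symm y0 y0 + b1 *\<^sub>R symm y1 y1) + 0 *\<^sub>R d"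
    unfolding e_def by (intro tendsto_add tendsto_scaleR tendsto_minus tendsto_const b z)
  also have "a0 *\<^sub>R (- symm x0 x0) + a1 *\<^sub>R (- symm x1 x1)
     + (b0 *\<^sub>R symm y0 y0 + b1 *\<^sub>R symm y1 y1) + 0 *\<^sub>R d
     = b0 *\<^sub>R symm y0 y0 - a0 *\<^sub>R symm x0 x0 + b1 *\<^sub>R symm y1 y1 - a1 *\<^sub>R symm x1 x1"
    by simp
  finally show ?thesis
    unfolding closure_sequential using m by (intro exI conjI allI)
qed

section \<open>Decomposing the allowed displacements along the cone\<close>

lemma open_separated: "open {d. separated d x y x' y'}"
proof -
  have "open {d. c \<noteq> 0 \<longrightarrow> c * lorentz_inner d w < 0}" for c w
  proof (cases "c = 0")
    case False
    have "open {d. c * lorentz_inner d w < 0}"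
      unfolding lorentz_inner_def by (intro open_Collect_less continuous_intros)
    with False show ?thesis by simp
  qed simp
  note * = this
  show ?thesis
    unfolding separated_def by (simp only: ball_simps) (intro open_Collect_conj * open_Collect_const)
qed

text \<open>Four vectors in a space of dimension three are dependent; this is the relation between
  the mixed ones.\<close>

lemma symm_relation:
  "wedge y y' * lorentz_inner v (symm x x') - wedge y x' * lorentz_inner v (symm x y')
   - wedge x y' * lorentz_inner v (symm y x') + wedge x x' * lorentz_inner v (symm y y') = 0"
  by (simp add: coord_simps algebra_simps)

lemma wedge_expand: "wedge x y *\<^sub>R z = wedge z y *\<^sub>R x + wedge x z *\<^sub>R y"
  by (simp add: wedge_def prod_eq_iff algebra_simps)

text \<open>Pairing with \<open>symm\<close> makes \<open>v\<close> a bilinear form on the plane,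
  which is determined by its values on a basis in each argument.\<close>

lemma eq_zero_if_symm_orthogonal:
  assumes "wedge x y \<noteq> 0" "wedge x' y' \<noteq> 0"
    and "lorentz_inner v (symm x x') = 0" "lorentz_inner v (symm x y') = 0"
      "lorentz_inner v (symm y x') = 0" "lorentz_inner v (symm y y') = 0"
  shows "v = 0"
proof -
  have *: "lorentz_inner v (symm z w) = 0"
    if "lorentz_inner v (symm z x') = 0" "lorentz_inner v (symm z y') = 0" for z w
  proof -
    have "wedge x' y' * lorentz_inner v (symm z w) = lorentz_inner v (symm z (wedge x' y' *\<^sub>R w))"
      by (simp add: symm_linear lorentz_inner_linear)
    also have "\<dots> = 0"
      unfolding wedge_expand[of x' y' w] symm_linear lorentz_inner_linear using that by simp
    finally show ?thesis using assms(2) by simp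
  qed
  from *[OF assms(3,4)] *[OF assms(5,6)] show ?thesis
    using symm_basis[OF assms(1), of v] by simp
qed

text \<open>The pairings \<open>A\<close>, \<open>B\<close>, \<open>C\<close>, \<open>E\<close> have
  the signs \<open>sgn\<close> and satisfy \<open>rel\<close>, so that three of them determine
  \<open>d\<close>. Three rays suffice in each case: always \<open>symm y0 y0\<close> and
  \<open>- symm x0 x0\<close>, and as third one \<open>symm y1 y1\<close> if
  \<open>A * Q \<le> B * T\<close>, otherwise \<open>- symm x1 x1\<close>. The coefficients solve
  the resulting linear system.\<close>

lemma separated_decomposition:
  assumes "wedge x0 y0 > 0" "wedge x1 y1 > 0" "wedge x0 y1 > 0" "wedge x1 y0 > 0" "wedge y1 y0 > 0"
    "wedge x0 x1 \<ge> 0" and sep: "separated d x0 y0 x1 y1"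
  obtains a0 a1 b0 b1 where "a0 \<ge> 0" "a1 \<ge> 0" "b0 \<ge> 0" "b1 \<ge> 0"
    "d = b0 *\<^sub>R symm y0 y0 - a0 *\<^sub>R symm x0 x0 + b1 *\<^sub>R symm y1 y1 - a1 *\<^sub>R symm x1 x1"
proof -
  define w0 w1 P Q S T where w: "w0 = wedge x0 y0" "w1 = wedge x1 y1" "P = wedge x0 x1"
    "Q = wedge y1 y0" "S = wedge x0 y1" "T = wedge x1 y0"
  have pos: "w0 > 0" "w1 > 0" "Q > 0" "S > 0" "T > 0" "P \<ge> 0" using assms by (simp_all add: w)
  have wedge: "wedge x0 y0 = w0" "wedge y0 x0 = - w0" "wedge x1 y1 = w1" "wedge y1 x1 = - w1"
    "wedge x0 x1 = P" "wedge x1 x0 = - P" "wedge y1 y0 = Q" "wedge y0 y1 = - Q"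
    "wedge x0 y1 = S" "wedge y1 x0 = - S" "wedge x1 y0 = T" "wedge y0 x1 = - T"
    by (simp_all add: w wedge_def)
  define A B C E where ABCE: "A = lorentz_inner d (symm x0 x1)" "B = lorentz_inner d (symm x0 y1)"
    "C = lorentz_inner d (symm y0 x1)" "E = lorentz_inner d (symm y0 y1)"
  have "P \<noteq> 0 \<longrightarrow> P * A < 0" "S * B < 0" "- T * C < 0" "- Q * E < 0"
    using sep pos unfolding separated_def wedge ABCE by (auto simp: wedge)
  then have sgn: "P \<noteq> 0 \<longrightarrow> A < 0" "B < 0" "C > 0" "E > 0"
    using pos by (auto simp: mult_less_0_iff zero_less_mult_iff)
  have rel: "- Q * A + T * B - S * C + P * E = 0"
    using symm_relation[of y0 y1 d x0 x1] by (simp add: wedge ABCE)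
  \<comment> \<open>With \<open>A\<close> and \<open>B\<close> matched, \<open>symm_relation\<close>
    links the remaining two pairings: \<open>E\<close> yields \<open>C\<close> since
    \<open>S > 0\<close>, while \<open>C\<close> yields \<open>E\<close> only for nonzero
    \<open>P\<close>.\<close>
  have eqI: "d = v" if "lorentz_inner v (symm x0 y1) = B"
      "lorentz_inner v (symm x0 x1) = A"
      "lorentz_inner v (symm y0 y1) = E \<or> lorentz_inner v (symm y0 x1) = C \<and> P \<noteq> 0" for v
  proof -
    let ?z = "d - v"
    have r: "- Q * lorentz_inner ?z (symm x0 x1) + T * lorentz_inner ?z (symm x0 y1)
       - S * lorentz_inner ?z (symm y0 x1) + P * lorentz_inner ?z (symm y0 y1) = 0"
      using symm_relation[of y0 y1 ?z x0 x1] by (simp add: wedge)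
    have 1: "lorentz_inner ?z (symm x0 x1) = 0" "lorentz_inner ?z (symm x0 y1) = 0"
      using that by (simp_all add: lorentz_inner_linear ABCE)
    have 2: "lorentz_inner ?z (symm y0 y1) = 0 \<or> lorentz_inner ?z (symm y0 x1) = 0 \<and> P \<noteq> 0"
      using that(3) by (auto simp: lorentz_inner_linear ABCE)
    have "S * lorentz_inner ?z (symm y0 x1) = P * lorentz_inner ?z (symm y0 y1)"
      using r 1 by simp
    with 2 pos have "lorentz_inner ?z (symm y0 x1) = 0" "lorentz_inner ?z (symm y0 y1) = 0" by auto
    with 1 have "?z = 0"
      using eq_zero_if_symm_orthogonal[of x0 y0 x1 y1 ?z] pos wedge by simp
    then show ?thesis by simp
  qed
  show ?thesis
  proof (cases "A * Q \<le> B * T")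
    case True
    define b0 where "b0 = - B / (2 * w0 * Q)"
    define a0 where "a0 = E / (2 * w0 * S)"
    define b1 where "b1 = (B * T - A * Q) / (2 * S * w1 * Q)"
    have nn: "a0 \<ge> 0" "b0 \<ge> 0" "b1 \<ge> 0"
      using pos sgn True by (simp_all add: a0_def b0_def b1_def divide_nonneg_nonneg divide_nonpos_nonneg)
    have b: "2 * w0 * Q * b0 = - B" "2 * w0 * S * a0 = E" "2 * S * w1 * Q * b1 = B * T - A * Q"
      using pos by (simp_all add: a0_def b0_def b1_def)
    have "d = b0 *\<^sub>R symm y0 y0 - a0 *\<^sub>R symm x0 x0 + b1 *\<^sub>R symm y1 y1 - 0 *\<^sub>R symm x1 x1"
      (is "d = ?v")
    proof (rule eqI)
      show "lorentz_inner ?v (symm x0 y1) = B"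
        using b(1) by (simp add: lorentz_inner_linear lorentz_inner_symm wedge algebra_simps)
      have "Q * (2 * w0 * T * b0 + 2 * S * w1 * b1) = Q * (- A)" using b(1,3) by algebra
      then have "2 * w0 * T * b0 + 2 * S * w1 * b1 = - A" using pos unfolding mult_cancel_left by simp
      then show "lorentz_inner ?v (symm x0 x1) = A"
        by (simp add: lorentz_inner_linear lorentz_inner_symm wedge algebra_simps)
      show "lorentz_inner ?v (symm y0 y1) = E \<or> lorentz_inner ?v (symm y0 x1) = C \<and> P \<noteq> 0"
        using b(2) by (simp add: lorentz_inner_linear lorentz_inner_symm wedge algebra_simps)
    qed
    with that[of a0 0 b0 b1] nn show ?thesis by simp
  next
    case False
    \<comment> \<open>A shared end belongs to the first case: for \<open>P = 0\<close>,
      \<open>rel\<close> makes \<open>B * T - A * Q\<close> equal to the positive number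
      \<open>S * C\<close>.\<close>
    have "P \<noteq> 0"
    proof
      assume "P = 0"
      with rel have "B * T - A * Q = S * C" by (simp add: algebra_simps)
      with False pos sgn show False by (smt (verit) mult_pos_pos)
    qed
    with pos have P: "P > 0" by simp
    define b0 where "b0 = - A / (2 * w0 * T)"
    define a0 where "a0 = C / (2 * w0 * P)"
    define a1 where "a1 = (A * Q - B * T) / (2 * P * w1 * T)"
    have nn: "a0 \<ge> 0" "b0 \<ge> 0" "a1 \<ge> 0"
      using pos P sgn False by (simp_all add: a0_def b0_def a1_def divide_nonneg_nonneg divide_nonpos_nonneg)
    have b: "2 * w0 * T * b0 = - A" "2 * w0 * P * a0 = C" "2 * P * w1 * T * a1 = A * Q - B * T"
      using pos P by (simp_all add: a0_def b0_def a1_def)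
    have "d = b0 *\<^sub>R symm y0 y0 - a0 *\<^sub>R symm x0 x0 + 0 *\<^sub>R symm y1 y1 - a1 *\<^sub>R symm x1 x1"
      (is "d = ?v")
    proof (rule eqI)
      have "T * (2 * w0 * Q * b0 + 2 * P * w1 * a1) = T * (- B)" using b(1,3) by algebra
      then have "2 * w0 * Q * b0 + 2 * P * w1 * a1 = - B" using pos unfolding mult_cancel_left by simp
      then show "lorentz_inner ?v (symm x0 y1) = B"
        by (simp add: lorentz_inner_linear lorentz_inner_symm wedge algebra_simps)
      show "lorentz_inner ?v (symm x0 x1) = A"
        using b(1) by (simp add: lorentz_inner_linear lorentz_inner_symm wedge algebra_simps)
      show "lorentz_inner ?v (symm y0 y1) = E \<or> lorentz_inner ?v (symm y0 x1) = C \<and> P \<noteq> 0"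
        using b(2) \<open>P \<noteq> 0\<close> by (simp add: lorentz_inner_linear lorentz_inner_symm wedge algebra_simps)
    qed
    with that[of a0 a1 b0 0] nn show ?thesis by simp
  qed
qed

lemma separated_imp_displacement:
  assumes "wedge x0 y0 > 0" "wedge x1 y1 > 0" "wedge x0 y1 > 0" "wedge x1 y0 > 0" "wedge y1 y0 > 0"
    "wedge x0 x1 \<ge> 0" and "separated d x0 y0 x1 y1"
  shows "d \<in> displacements (interp x0 x1) (interp y0 y1) {0<..} {0<..}"
proof -
  let ?D = "displacements (interp x0 x1) (interp y0 y1) {0<..} {0<..}"
  have "{d. separated d x0 y0 x1 y1} \<subseteq> closure ?D"
  proof clarify
    fix d assume "separated d x0 y0 x1 y1"
    from separated_decomposition[OF assms(1-6) this] show "d \<in> closure ?D"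
      using cone_subset_closure_displacements by metis
  qed
  then have "d \<in> interior (closure ?D)"
    using interior_maximal[OF _ open_separated] assms(7) by blast
  also have "\<dots> \<subseteq> rel_interior (closure ?D)" by (rule interior_subset_rel_interior)
  also have "\<dots> = rel_interior ?D"
    by (rule convex_rel_interior_closure) (rule convex_displacements)
  also have "\<dots> \<subseteq> ?D" by (rule rel_interior_subset)
  finally show ?thesis .
qed

subsection \<open>The foliation\<close>

lemma wedge_interp:
  "wedge (interp a b s) z = (1 - s) * wedge a z + s * wedge b z"
  "wedge z (interp a b s) = (1 - s) * wedge z a + s * wedge z b"
  "wedge (interp a b s) (interp a b t) = (t - s) * wedge a b"
  by (simp_all add: interp_def wedge_def algebra_simps)

lemma wedge_interp_pos:
  assumes "wedge x0 y0 > 0" "wedge x1 y1 > 0" "wedge x0 y1 > 0" "wedge x1 y0 > 0" "s \<in> {0..1}" "t \<in> {0..1}"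
  shows "wedge (interp x0 x1 s) (interp y0 y1 t) > 0"
proof -
  have *: "(1 - r) * a + r * b > 0" if "a > 0" "b > 0" "r \<in> {0..1}" for a b r :: real
    using that by (cases "r = 0") (auto intro!: add_nonneg_pos)
  show ?thesis
    unfolding wedge_interp(1) by (intro * assms(5)) (simp_all only: wedge_interp(2), (intro * assms)+)
qed

text \<open>Between times \<open>s\<close> and \<open>t\<close> each pairing is strictly monotone
  along the drift, because at every intermediate time \<open>r\<close> the ends stand in the cyclic
  order \<open>?X s\<close>, \<open>?X r\<close>, \<open>?X t\<close>, \<open>?Y t\<close>,
  \<open>?Y r\<close>, \<open>?Y s\<close>.\<close>

lemma drift_separated:
  assumes "wedge x0 y0 > 0" "wedge x1 y1 > 0" "wedge x0 y1 > 0" "wedge x1 y0 > 0" "wedge y1 y0 > 0"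
    "wedge x0 x1 \<ge> 0" and p: "p \<in> drifts (interp x0 x1) (interp y0 y1) {0<..} {0<..}"
    and st: "0 \<le> s" "s < t" "t \<le> 1"
  shows "separated (p t - p s) (interp x0 x1 s) (interp y0 y1 s) (interp x0 x1 t) (interp y0 y1 t)"
proof -
  let ?X = "interp x0 x1" and ?Y = "interp y0 y1"
  from p obtain \<alpha> \<beta> where ab: "\<And>r. r \<in> {0..1} \<Longrightarrow> \<alpha> r > 0" "\<And>r. r \<in> {0..1} \<Longrightarrow> \<beta> r > 0"
    and der: "\<And>r. r \<in> {0..1} \<Longrightarrow>
      (p has_vector_derivative (\<beta> r *\<^sub>R symm (?Y r) (?Y r) - \<alpha> r *\<^sub>R symm (?X r) (?X r))) (at r within {0..1})"
    unfolding drifts_def mem_Collect_eq greaterThan_iff by blast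
  \<comment> \<open>By the mean value theorem the sign of the derivative decides. The condition on
    \<open>?X\<close> is not strict, as \<open>x0\<close> and \<open>x1\<close> may span the same
    line; strictness comes from \<open>?Y\<close>.\<close>
  have decr: "wedge e f * lorentz_inner (p t - p s) (symm e f) < 0"
    if X: "\<And>r. s < r \<Longrightarrow> r < t \<Longrightarrow> wedge e f * (wedge (?X r) e * wedge (?X r) f) \<le> 0"
      and Y: "\<And>r. s < r \<Longrightarrow> r < t \<Longrightarrow> wedge e f * (wedge (?Y r) e * wedge (?Y r) f) > 0" for e f
  proof -
    let ?l = "\<lambda>v. wedge e f * lorentz_inner v (symm e f)"
    have "linear ?l"
      by (rule linearI) (simp_all add: lorentz_inner_linear algebra_simps)
    then have bl: "bounded_linear ?l" by (simp add: linear_conv_bounded_linear)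
    let ?p' = "\<lambda>r. \<beta> r *\<^sub>R symm (?Y r) (?Y r) - \<alpha> r *\<^sub>R symm (?X r) (?X r)"
    have "((\<lambda>r. ?l (p r)) has_derivative (\<lambda>h. h * ?l (?p' r))) (at r within {s..t})" if "s \<le> r" "r \<le> t" for r
    proof -
      have "(p has_vector_derivative ?p' r) (at r within {s..t})"
        by (rule has_vector_derivative_within_subset[OF der]) (use that st in auto)
      from bounded_linear.has_vector_derivative[OF bl this] show ?thesis
        by (simp add: has_vector_derivative_def)
    qed
    from mvt_simple[OF st(2) this] obtain r where r: "r \<in> {s<..<t}" "?l (p t) - ?l (p s) = (t - s) * ?l (?p' r)"
      by blast
    have "?l (?p' r) = 2 * (\<alpha> r * (wedge e f * (wedge (?X r) e * wedge (?X r) f)))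
       - 2 * (\<beta> r * (wedge e f * (wedge (?Y r) e * wedge (?Y r) f)))"
      by (simp add: lorentz_inner_linear lorentz_inner_symm algebra_simps)
    moreover have "\<alpha> r * (wedge e f * (wedge (?X r) e * wedge (?X r) f)) \<le> 0"
      using r st by (intro mult_nonneg_nonpos less_imp_le[OF ab(1)] X) auto
    moreover have "\<beta> r * (wedge e f * (wedge (?Y r) e * wedge (?Y r) f)) > 0"
      using r st by (intro mult_pos_pos[OF ab(2)] Y) auto
    ultimately have "?l (?p' r) < 0" by linarith
    with r(2) st(2) have "?l (p t) - ?l (p s) < 0" by (simp add: mult_pos_neg)
    then show ?thesis by (simp add: lorentz_inner_linear algebra_simps)
  qed
  have XY: "wedge (?X a) (?Y b) > 0" if "a \<in> {0..1}" "b \<in> {0..1}" for a b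
    by (rule wedge_interp_pos) (use assms that in auto)
  have YX: "wedge (?Y b) (?X a) < 0" if "a \<in> {0..1}" "b \<in> {0..1}" for a b
    using XY[OF that] wedge_swap[of "?Y b" "?X a"] by simp
  have XX: "wedge (?X a) (?X b) \<ge> 0" if "a \<le> b" for a b
    using that assms by (simp add: wedge_interp(3))
  have XX': "wedge (?X b) (?X a) \<le> 0" if "a \<le> b" for a b
    using that assms by (simp add: wedge_interp(3) mult_nonpos_nonneg)
  have YY: "wedge (?Y a) (?Y b) < 0" if "a < b" for a b
    using that assms wedge_swap[of y1 y0] by (simp add: wedge_interp(3) mult_pos_neg)
  have YY': "wedge (?Y b) (?Y a) > 0" if "a < b" for a b
    using YY[OF that] wedge_swap[of "?Y b" "?Y a"] by simp
  have m: "s \<in> {0..1}" "t \<in> {0..1}" using st by auto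
  show ?thesis
    unfolding separated_def
  proof (intro ballI impI)
    fix e f assume ef: "e \<in> {?X s, ?Y s}" "f \<in> {?X t, ?Y t}" "wedge e f \<noteq> 0"
    show "wedge e f * lorentz_inner (p t - p s) (symm e f) < 0"
    proof (rule decr)
      fix r assume r: "s < r" "r < t"
      with st have rm: "r \<in> {0..1}" by auto
      note signs = XY[OF m(1) m(2)] XY[OF rm m(1)] XY[OF rm m(2)] YX[OF m(1) rm] YX[OF m(2) rm] YX[OF m(2) m(1)]
        XX[of r t] XX[of s t] XX'[of s r] YY[of s t] YY[of r t] YY'[of s r]
      have "wedge (?X s) (?X t) > 0" if "wedge (?X s) (?X t) \<noteq> 0"
        using signs(8) st that by auto
      with ef r st signs show "wedge e f * (wedge (?X r) e * wedge (?X r) f) \<le> 0"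
        "wedge e f * (wedge (?Y r) e * wedge (?Y r) f) > 0"
        by (auto simp: mult_le_0_iff zero_less_mult_iff zero_le_mult_iff mult_less_0_iff)
    qed
  qed
qed

text \<open>The wedge of two linear spinor paths is a quadratic polynomial, here without zeros on
  the unit interval, so the directing vector is a rational curve.\<close>

lemma smooth_ends:
  assumes "wedge x0 y0 > 0" "wedge x1 y1 > 0" "wedge x0 y1 > 0" "wedge x1 y0 > 0"
  shows "smooth_curve_on {0..1} (\<lambda>t. (1 / wedge (interp x0 x1 t) (interp y0 y1 t)) *\<^sub>R
    symm (interp x0 x1 t) (interp y0 y1 t))"
proof -
  let ?L = "[:1, -1:] :: real poly" and ?M = "[:0, 1:] :: real poly"
  define Q where "Q = smult (wedge x0 y0) (?L * ?L) + smult (wedge x0 y1) (?L * ?M)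
    + smult (wedge x1 y0) (?M * ?L) + smult (wedge x1 y1) (?M * ?M)"
  have Q: "poly Q t = wedge (interp x0 x1 t) (interp y0 y1 t)" for t
    by (simp add: Q_def wedge_interp algebra_simps)
  have nz: "poly Q t \<noteq> 0" if "t \<in> {0..1}" for t
    using wedge_interp_pos[OF assms that that] by (simp add: Q)
  have "(1 / wedge (interp x0 x1 t) (interp y0 y1 t)) *\<^sub>R symm (interp x0 x1 t) (interp y0 y1 t) =
     (poly (?L * ?L) t / poly Q t) *\<^sub>R symm x0 y0 + (poly (?L * ?M) t / poly Q t) *\<^sub>R symm x0 y1
     + (poly (?M * ?L) t / poly Q t) *\<^sub>R symm x1 y0 + (poly (?M * ?M) t / poly Q t) *\<^sub>R symm x1 y1" for t
    unfolding Q[symmetric] unfolding interp_def symm_linear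
    by (simp add: vec_eq_iff divide_inverse algebra_simps)
  then show ?thesis
    by (simp only:) (intro smooth_curve_on_add smooth_curve_on_rational nz)
qed

text \<open>The sign conditions put the ends in the cyclic order \<open>x0\<close>,
  \<open>x1\<close>, \<open>y1\<close>, \<open>y0\<close>, where \<open>x0\<close> and
  \<open>x1\<close> may coincide as ends. A drift with displacement \<open>p1 - p0\<close> is
  translated to start at \<open>p0\<close>.\<close>

lemma foliation_ordered_ends:
  assumes pos: "wedge x0 y0 > 0" "wedge x1 y1 > 0" "wedge x0 y1 > 0" "wedge x1 y0 > 0" "wedge y1 y0 > 0"
    "wedge x0 x1 \<ge> 0" and disj: "ends_plane p0 x0 y0 \<inter> ends_plane p1 x1 y1 = {}"
  shows "\<exists>F. crooked_foliation F \<and> F 0 = ends_plane p0 x0 y0 \<and> F 1 = ends_plane p1 x1 y1"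
proof -
  let ?X = "interp x0 x1" and ?Y = "interp y0 y1"
  have "separated (p1 - p0) x0 y0 x1 y1"
    using disj pos by (intro disjoint_imp_separated) auto
  from separated_imp_displacement[OF pos this] obtain q
    where q: "q \<in> drifts ?X ?Y {0<..} {0<..}" and q1: "p1 - p0 = q 1 - q 0"
    by (auto simp: displacements_def)
  define p where "p t = (p0 - q 0) + q t" for t
  define F where "F t = ends_plane (p t) (?X t) (?Y t)" for t
  have XY: "wedge (?X s) (?Y t) > 0" if "s \<in> {0..1}" "t \<in> {0..1}" for s t
    by (rule wedge_interp_pos) (use pos that in auto)
  have disj': "F s \<inter> F t = {}" if "0 \<le> s" "s < t" "t \<le> 1" for s t
    unfolding F_def
  proof (rule separated_imp_disjoint)
    show "separated (p t - p s) (?X s) (?Y s) (?X t) (?Y t)"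
      using drift_separated[OF pos q that] by (simp add: p_def)
    show "wedge (?X s) (?Y s) \<noteq> 0" "wedge (?X t) (?Y t) \<noteq> 0" "wedge (?X s) (?Y t) \<noteq> 0"
      using XY[of s s] XY[of t t] XY[of s t] that by auto
    show "wedge (?Y s) (?X t) \<noteq> 0"
      using XY[of t s] wedge_swap[of "?Y s" "?X t"] that by auto
    show "wedge (?Y s) (?Y t) \<noteq> 0"
      using pos(5) wedge_swap[of y1 y0] that by (simp add: wedge_interp(3))
  qed
  have "disjoint_family_on F {0..1}"
    unfolding disjoint_family_on_def
  proof (intro ballI impI)
    fix s t :: real assume "s \<in> {0..1}" "t \<in> {0..1}" "s \<noteq> t"
    then show "F s \<inter> F t = {}"
      using disj'[of s t] disj'[of t s] by (cases "s < t") auto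
  qed
  moreover have "smooth_crooked_family F"
    unfolding smooth_crooked_family_def
  proof (intro exI conjI ballI)
    show "smooth_curve_on {0..1} p"
      unfolding p_def using q by (intro smooth_curve_on_add smooth_curve_on_const) (simp add: drifts_def)
    show "smooth_curve_on {0..1} (\<lambda>t. (1 / wedge (?X t) (?Y t)) *\<^sub>R symm (?X t) (?Y t))"
      by (rule smooth_ends[OF pos(1-4)])
    fix t :: real assume "t \<in> {0..1}"
    then show "unit_spacelike ((1 / wedge (?X t) (?Y t)) *\<^sub>R symm (?X t) (?Y t))"
      using XY[of t t] by (intro unit_spacelike_symm) auto
    show "F t = crooked_plane_at (p t) ((1 / wedge (?X t) (?Y t)) *\<^sub>R symm (?X t) (?Y t))"
      by (simp add: F_def ends_plane_def)
  qed
  moreover have "F 0 = ends_plane p0 x0 y0" by (simp add: F_def p_def interp_def)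
  moreover have "p 1 = p1" using q1 by (simp add: p_def algebra_simps)
  then have "F 1 = ends_plane p1 x1 y1" by (simp add: F_def interp_def)
  ultimately show ?thesis unfolding crooked_foliation_def by blast
qed

section \<open>Reduction to ordered ends\<close>

lemma crooked_foliation_reverse:
  assumes "crooked_foliation F"
  shows "crooked_foliation (\<lambda>t. F (1 - t))"
proof -
  from assms obtain p u where "smooth_curve_on {0..1} p" "smooth_curve_on {0..1} u"
    "\<forall>t\<in>{0..1}. unit_spacelike (u t) \<and> F t = crooked_plane_at (p t) (u t)"
    and disj: "disjoint_family_on F {0..1}"
    unfolding crooked_foliation_def smooth_crooked_family_def by blast
  then have "smooth_crooked_family (\<lambda>t. F (1 - t))"
    unfolding smooth_crooked_family_def
    by (intro exI[of _ "\<lambda>t. p (1 - t)"] exI[of _ "\<lambda>t. u (1 - t)"]) (simp add: smooth_curve_on_reflect)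
  moreover have "disjoint_family_on (\<lambda>t. F (1 - t)) {0..1}"
    using disj by (auto simp: disjoint_family_on_def)
  ultimately show ?thesis by (simp add: crooked_foliation_def)
qed

text \<open>Spinors are determined by their ends only up to sign. Negating \<open>x\<close> and
  \<open>y\<close> together makes \<open>wedge y y'\<close> negative; the signs of the mixed wedges
  then tell which of the two planes has to come first.\<close>

lemma foliation_unlinked_ends:
  assumes w: "wedge x y = 1" "wedge x' y' = 1"
    and sgn: "wedge x x' * wedge y y' \<le> 0" "wedge x y' * wedge y x' < 0" "wedge y y' \<noteq> 0"
    and disj: "ends_plane p x y \<inter> ends_plane p' x' y' = {}"
  shows "\<exists>F. crooked_foliation F \<and> F 0 = ends_plane p x y \<and> F 1 = ends_plane p' x' y'"
proof -
  have neg: "\<exists>F. crooked_foliation F \<and> F 0 = ends_plane p x y \<and> F 1 = ends_plane p' x' y'"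
    if w: "wedge x y = 1" and sgn: "wedge x x' * wedge y y' \<le> 0" "wedge x y' * wedge y x' < 0" "wedge y y' < 0"
      and disj: "ends_plane p x y \<inter> ends_plane p' x' y' = {}" for x y
  proof -
    have A: "wedge x x' \<ge> 0" using sgn(1,3) by (auto simp: mult_le_0_iff)
    consider "wedge x y' > 0" "wedge y x' < 0" | "wedge x y' < 0" "wedge y x' > 0"
      using sgn(2) by (auto simp: mult_less_0_iff)
    then show ?thesis
    proof cases
      case 1
      then show ?thesis
        using w \<open>wedge x' y' = 1\<close> A sgn(3) disj wedge_swap[of y x'] wedge_swap[of y y']
        by (intro foliation_ordered_ends) auto
    next
      \<comment> \<open>Here the planes are in the opposite order: the foliation is built from the
        second to the first, with negated spinors, and then reversed.\<close>
      case 2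
      have "\<exists>F. crooked_foliation F \<and> F 0 = ends_plane p' (- x') (- y') \<and> F 1 = ends_plane p x y"
        using w \<open>wedge x' y' = 1\<close> A sgn(3) disj 2
          wedge_swap[of y x'] wedge_swap[of y y'] wedge_swap[of x x'] wedge_swap[of x y']
        by (intro foliation_ordered_ends) (auto simp: wedge_linear ends_plane_minus)
      then obtain F where "crooked_foliation F" "F 0 = ends_plane p' x' y'" "F 1 = ends_plane p x y"
        by (auto simp: ends_plane_minus)
      then show ?thesis
        using crooked_foliation_reverse[of F] by (intro exI[of _ "\<lambda>t. F (1 - t)"]) auto
    qed
  qed
  show ?thesis
  proof (cases "wedge y y' < 0")
    case True
    with neg[of x y] assms show ?thesis by blast
  next
    case False
    with neg[of "- x" "- y"] assms show ?thesis by (simp add: wedge_linear ends_plane_minus)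
  qed
qed

text \<open>The negation describes equal or crossing geodesics. With \<open>x'\<close> and
  \<open>y'\<close> written in the basis \<open>x\<close>, \<open>y\<close>, the inequalities at
  \<open>x\<close> then give \<open>b < 0\<close> and those at \<open>y\<close> give
  \<open>b > 0\<close>.\<close>

lemma separated_imp_unlinked:
  assumes w: "wedge x y = 1" "wedge x' y' = 1" and sep: "separated d x y x' y'"
  shows "(wedge x x' * wedge y y') * (wedge x y' * wedge y x') > 0
     \<or> wedge x x' = 0 \<and> wedge y y' \<noteq> 0 \<or> wedge y y' = 0 \<and> wedge x x' \<noteq> 0
     \<or> wedge x y' = 0 \<and> wedge y x' \<noteq> 0 \<or> wedge y x' = 0 \<and> wedge x y' \<noteq> 0"
proof (rule ccontr)
  define A B C E where ABCE: "A = wedge x x'" "B = wedge x y'" "C = wedge y x'" "E = wedge y y'"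
  define a b c where abc: "a = lorentz_inner d (symm x x)" "b = lorentz_inner d (symm x y)"
    "c = lorentz_inner d (symm y y)"
  have x': "x' = (- C) *\<^sub>R x + A *\<^sub>R y" and y': "y' = (- E) *\<^sub>R x + B *\<^sub>R y"
    using wedge_expand[of x y x'] wedge_expand[of x y y'] w(1)
    by (simp_all add: ABCE wedge_swap[of x' y] wedge_swap[of y' y])
  have pl: "A * E - B * C = 1"
    using w(2) unfolding x' y' wedge_linear by (simp add: w(1) wedge_swap[of y x] algebra_simps)
  have "lorentz_inner d (symm x x') = A * b - C * a" "lorentz_inner d (symm x y') = B * b - E * a"
    "lorentz_inner d (symm y x') = A * c - C * b" "lorentz_inner d (symm y y') = B * c - E * b"
    unfolding x' y' symm_linear lorentz_inner_linear abc symm_swap[of y x] by simp_all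
  then have s: "A \<noteq> 0 \<Longrightarrow> A * (A * b - C * a) < 0" "B \<noteq> 0 \<Longrightarrow> B * (B * b - E * a) < 0"
    "C \<noteq> 0 \<Longrightarrow> C * (A * c - C * b) < 0" "E \<noteq> 0 \<Longrightarrow> E * (B * c - E * b) < 0"
    using sep by (auto simp: separated_def ABCE)
  assume "\<not> ?thesis"
  then have neg: "(A * E) * (B * C) \<le> 0" "A = 0 \<longleftrightarrow> E = 0" "B = 0 \<longleftrightarrow> C = 0"
    by (auto simp: ABCE)
  show False
  proof (cases "A = 0 \<or> B = 0")
    case True
    then consider "A = 0" "E = 0" "B \<noteq> 0" "C \<noteq> 0" | "B = 0" "C = 0" "A \<noteq> 0" "E \<noteq> 0"
      using neg pl by auto
    then show False
      by cases (use s in \<open>auto simp: mult_less_0_iff zero_less_mult_iff\<close>)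
  next
    case False
    with neg have nz: "A \<noteq> 0" "B \<noteq> 0" "C \<noteq> 0" "E \<noteq> 0" by auto
    \<comment> \<open>The geodesics cross: \<open>l *\<^sub>R symm x' x' + m *\<^sub>R symm y' y'\<close> is a timelike vector in both stems.\<close>
    define l m where lm: "l = \<bar>B * E\<bar>" "m = \<bar>A * C\<bar>"
    have l: "l > 0" "m > 0" using nz by (simp_all add: lm)
    have "\<bar>v\<bar> * u + \<bar>u\<bar> * v = 0" if "u * v \<le> 0" for u v :: real
      using that by (auto simp: mult_le_0_iff abs_if)
    moreover have "(A * C) * (B * E) \<le> 0" using neg(1) by (simp add: mult_ac)
    ultimately have z: "l * (A * C) + m * (B * E) = 0"
      unfolding lm by blast
    \<comment> \<open>The weights satisfy \<open>z\<close>, which removes \<open>a\<close> from this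
      sum and \<open>c\<close> from the corresponding sum at \<open>y\<close>; both become multiples
      of \<open>b\<close>.\<close>
    have "l * (A * (A * b - C * a)) + m * (B * (B * b - E * a)) < 0"
      by (intro add_neg_neg mult_pos_neg[OF l(1) s(1)] mult_pos_neg[OF l(2) s(2)] nz)
    moreover have "l * (A * (A * b - C * a)) + m * (B * (B * b - E * a)) = (l * A\<^sup>2 + m * B\<^sup>2) * b"
      using z by algebra
    ultimately have "(l * A\<^sup>2 + m * B\<^sup>2) * b < 0" by simp
    moreover have "l * A\<^sup>2 + m * B\<^sup>2 \<ge> 0" using l by simp
    ultimately have "b < 0" by (simp add: mult_less_0_iff)
    have "l * (C * (A * c - C * b)) + m * (E * (B * c - E * b)) < 0"
      by (intro add_neg_neg mult_pos_neg[OF l(1) s(3)] mult_pos_neg[OF l(2) s(4)] nz)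
    moreover have "l * (C * (A * c - C * b)) + m * (E * (B * c - E * b)) = - ((l * C\<^sup>2 + m * E\<^sup>2) * b)"
      using z by algebra
    ultimately have "(l * C\<^sup>2 + m * E\<^sup>2) * b > 0" by simp
    moreover have "l * C\<^sup>2 + m * E\<^sup>2 \<ge> 0" using l by simp
    ultimately show False using \<open>b < 0\<close> by (simp add: zero_less_mult_iff)
  qed
qed

text \<open>Replacing \<open>x, y\<close> by \<open>y, - x\<close> keeps both the plane and the
  wedge. Doing so for either plane, or for both, brings every unlinked configuration into the form
  with \<open>x\<close>, \<open>x'\<close> as the only pair that may coincide.\<close>

lemma foliation_disjoint_ends:
  assumes w: "wedge x y = 1" "wedge x' y' = 1"
    and disj: "ends_plane p x y \<inter> ends_plane p' x' y' = {}"
  shows "\<exists>F. crooked_foliation F \<and> F 0 = ends_plane p x y \<and> F 1 = ends_plane p' x' y'"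
proof -
  define A B C E where ABCE: "A = wedge x x'" "B = wedge x y'" "C = wedge y x'" "E = wedge y y'"
  have "wedge x y * wedge x' y' = A * E - B * C"
    by (simp add: ABCE wedge_def algebra_simps)
  then have pl: "A * E - B * C = 1" using w by simp
  have wedge: "wedge y x = - 1" "wedge y' x' = - 1"
    using w wedge_swap[of y x] wedge_swap[of y' x'] by simp_all
  have sep: "separated (p' - p) x y x' y'"
    by (rule disjoint_imp_separated) (use assms in auto)
  have lem: "\<exists>F. crooked_foliation F \<and> F 0 = ends_plane p x y \<and> F 1 = ends_plane p' x' y'"
    if "A * E \<le> 0" "B * C < 0" "E \<noteq> 0"
    using foliation_unlinked_ends[OF w _ _ _ disj] that by (simp add: ABCE)
  have swap1: "\<exists>F. crooked_foliation F \<and> F 0 = ends_plane p x y \<and> F 1 = ends_plane p' x' y'"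
    if "C * B \<ge> 0" "A * E > 0" "B \<noteq> 0"
    using foliation_unlinked_ends[of y "- x" x' y' p p'] that w disj
    by (simp add: ABCE wedge_linear wedge ends_plane_minus ends_plane_swap mult_ac)
  have swap2: "\<exists>F. crooked_foliation F \<and> F 0 = ends_plane p x y \<and> F 1 = ends_plane p' x' y'"
    if "C * B \<ge> 0" "A * E > 0" "C \<noteq> 0"
    using foliation_unlinked_ends[of x y y' "- x'" p p'] that w disj
    by (simp add: ABCE wedge_linear wedge ends_plane_minus ends_plane_swap mult_ac)
  have swap12: "\<exists>F. crooked_foliation F \<and> F 0 = ends_plane p x y \<and> F 1 = ends_plane p' x' y'"
    if "A * E \<le> 0" "B * C < 0" "A \<noteq> 0"
    using foliation_unlinked_ends[of y "- x" y' "- x'" p p'] that w disj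
    by (simp add: ABCE wedge_linear wedge ends_plane_minus ends_plane_swap mult_ac)
  \<comment> \<open>Two cases with four distinct ends, then four with exactly one shared end; in the
    latter \<open>pl\<close> supplies the missing sign.\<close>
  from separated_imp_unlinked[OF w sep] consider
    "A * E > 0" "B * C > 0" | "A * E < 0" "B * C < 0" | "A = 0" "E \<noteq> 0" | "E = 0" "A \<noteq> 0" | "B = 0" "C \<noteq> 0" | "C = 0" "B \<noteq> 0"
    unfolding ABCE[symmetric] zero_less_mult_iff[of "A * E"] by blast
  then show ?thesis
  proof cases
    case 1
    then have "B \<noteq> 0" by auto
    with 1 show ?thesis using swap1 by (simp add: mult.commute)
  next
    case 2
    then have "E \<noteq> 0" by auto
    with 2 show ?thesis using lem by simp
  next
    case 3 then show ?thesis using lem pl by auto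
  next
    case 4 then show ?thesis using swap12 pl by auto
  next
    case 5 then show ?thesis using swap2 pl by auto
  next
    case 6 then show ?thesis using swap1 pl by auto
  qed
qed

theorem theorem1:
  fixes C C' :: "(real^3) set"
  assumes "crooked_plane C" and "crooked_plane C'" and "C \<inter> C' = {}"
  shows "\<exists>F :: real \<Rightarrow> (real^3) set. crooked_foliation F \<and> F 0 = C \<and> F 1 = C'"
proof -
  have ends: "\<exists>p x y. wedge x y = 1 \<and> D = ends_plane p x y" if "crooked_plane D" for D
  proof -
    from that obtain p u where u: "unit_spacelike u" "D = crooked_plane_at p u"
      unfolding crooked_plane_def by blast
    from unit_spacelike_ends[OF u(1)] obtain x y where "wedge x y = 1" "symm x y = u" .
    with u(2) show ?thesis unfolding ends_plane_def by (metis div_by_1 scaleR_one)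
  qed
  from ends[OF assms(1)] ends[OF assms(2)] assms(3) show ?thesis
    using foliation_disjoint_ends by metis
qed

end
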